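(* Let $\mathbb{F}\subseteq\mathbb{C}$ be a subfield invariant under complex conjugation and let $m\ge 2$. A pair of $m\times mg$ matrices $(L,R)$ is a biorthogonal wavelet matrix pair of rank $m$ if and only if there exist primitive paraunitary matrices $V_1(z),\ldots,V_d(z)$, $d\ge 0$, and nilpotent matrices $N_i\in gl(m,\mathbb{F})$ with $N_i^2=0$, $1\le i\le r$, such that $$L(z)=z^{-k_0}V_1(z)\cdots V_d(z)\,L_{N_r}(z)\cdots L_{N_1}(z)\begin{pmatrix}1&0\\0&G\end{pmatrix}\mathbf{H},$$ $$R(z)=z^{-k_0}V_1(z)\cdots V_d(z)\,R_{N_r}(z)\cdots R_{N_1}(z)\begin{pmatrix}1&0\\0&(G^{-1})^{\ast}\end{pmatrix}\mathbf{H},$$ where $k_0\in\mathbb{Z}$, $d=b-mk_0$, $b$ is the exponent of $\det L(z)$ (i.e. $\det L(z)=c\,z^{-b}$ with $c\neq 0$ a constant), $G\in GL(m-1,\mathbb{F})$, $\mathbf{H}$ is the canonical Haar matrix of rank $m$, and $$L_{N_i}(z)=I_m-N_i+N_iz^{-k_i},\qquad R_{N_i}(z)=I_m+N_i^{\ast}-N_i^{\ast}z^{k_i},\qquad 1\le i\le r,$$ for some positive integers $k_i$, such that the genus of $C(z)=L_{N_r}(z)\cdots L_{N_1}(z)$ is $\le g$.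
   Context: Work over the Laurent polynomial ring $\mathbb{F}[z,z^{-1}]$. $gl(n,\mathbb{F})$ and $GL(n,\mathbb{F})$ denote all, respectively all invertible, $n\times n$ matrices over $\mathbb{F}$; $A^{\ast}$ is the conjugate transpose. For an $m\times m$ Laurent polynomial matrix $A(z)=\sum_{k=k_0}^{k_1}A_kz^{-k}$, with $k_0$ and $k_1$ the smallest and largest indices with $A_k\ne 0$, the genus is $k_1-k_0+1$. If $A(z)$ has genus $g$, it is identified with the $m\times mg$ block matrix $A=(A_{k_0},\ldots,A_{k_1})$, where $A_k=(a_{i,km+j})$, $0\le i,j\le m-1$. The adjoint is $\tilde A(z)=\sum_k A_k^{\ast}z^{k}$. A pair of $m\times mg$ matrices $(L=(l_{i,j}),R=(r_{i,j}))$, identified with the Laurent polynomial matrices $L(z)=\sum_k L_kz^{-k}$ and $R(z)=\sum_k R_kz^{-k}$ whose coefficients are the consecutive $m\times m$ blocks $L_k=(l_{i,km+j})$ and $R_k=(r_{i,km+j})$, $0\le i,j\le m-1$, of $L$ and $R$, is a biorthogonal wavelet matrix pair of rank $m$ and genus $g$ if $L(z)\tilde R(z)=mI_m$ and $$\sum_j l_{i,j}=\sum_j r_{i,j}=\begin{cases}m,& i=0,\\ 0,&1\le i\le m-1.\end{cases}$$ A primitive paraunitary matrix is one of the form $V(z)=I_m-vv^{\ast}+vv^{\ast}z^{-1}$ with $v\in\mathbb{F}^m$ a unit column vector ($v^{\ast}v=1$). The canonical Haar matrix $\mathbf{H}$ of rank $m$ is the constant $m\times m$ matrix with rows indexed $0,\dots,m-1$: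 row $0$ is $(1,1,\ldots,1)$, and for $1\le i\le m-1$, with $s=m-i$, row $i$ consists of $i-1$ zeros, then the entry $-s\sqrt{m/(s^2+s)}$, then $s$ entries equal to $\sqrt{m/(s^2+s)}$. It satisfies $\mathbf{H}\mathbf{H}^{\ast}=mI_m$.
   Formalization: Two conditions on F are added: the Haar matrix H has entries in F, and every nonzero vector of F^m has an F-multiple v with v*v=1. Without them the "only if" part fails, e.g. for F=Q with m=3 (H irrational) and with m=2 (no rational unit vector along (1,1)). *)

theory Defs
  imports
    Complex_Main
    "HOL-Library.Poly_Mapping"
    "Jordan_Normal_Form.Determinant"
    "Jordan_Normal_Form.Schur_Decomposition"
begin

text \<open>
  The convolution product of finitely supported functions on the group of integers is the
  multiplication of Laurent polynomials. The coefficient of \<open>z\<^sup>n\<close> in \<open>p\<close> is \<open>lookup p n\<close>; since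
  matrices are written as \<open>\<Sum>k. A\<^sub>k z\<^sup>-\<^sup>k\<close>, their coefficient \<open>A\<^sub>k\<close> is read off at \<open>- k\<close>.
\<close>

type_synonym laurent = "int \<Rightarrow>\<^sub>0 complex"

definition zpow :: "int \<Rightarrow> laurent" where
  "zpow n = Poly_Mapping.single n 1"

definition const_lmat :: "complex mat \<Rightarrow> laurent mat" where
  "const_lmat A = map_mat (Poly_Mapping.single 0) A"

definition lmat_coeff :: "laurent mat \<Rightarrow> int \<Rightarrow> complex mat" where
  "lmat_coeff A k = map_mat (\<lambda>p. Poly_Mapping.lookup p (- k)) A"

definition laurent_star :: "laurent \<Rightarrow> laurent" where
  "laurent_star p =
     (\<Sum>n\<in>Poly_Mapping.keys p. Poly_Mapping.single (- n) (cnj (Poly_Mapping.lookup p n)))"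

definition lmat_adjoint :: "laurent mat \<Rightarrow> laurent mat" where
  "lmat_adjoint A = mat (dim_col A) (dim_row A) (\<lambda>(i, j). laurent_star (A $$ (j, i)))"

text \<open>The genus is meant for nonzero matrices only.\<close>

definition lmat_support :: "laurent mat \<Rightarrow> int set" where
  "lmat_support A = {k. lmat_coeff A k \<noteq> 0\<^sub>m (dim_row A) (dim_col A)}"

definition lmat_genus :: "laurent mat \<Rightarrow> int" where
  "lmat_genus A = Max (lmat_support A) - Min (lmat_support A) + 1"

definition lmat_prod :: "nat \<Rightarrow> laurent mat list \<Rightarrow> laurent mat" where
  "lmat_prod m As = foldr (*) As (1\<^sub>m m)"

definition conj_subfield :: "complex set \<Rightarrow> bool" where
  "conj_subfield F \<longleftrightarrow>
     0 \<in> F \<and> 1 \<in> F \<and>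
     (\<forall>x\<in>F. \<forall>y\<in>F. x + y \<in> F \<and> x * y \<in> F) \<and>
     (\<forall>x\<in>F. - x \<in> F \<and> inverse x \<in> F \<and> cnj x \<in> F)"

definition mats_over :: "complex set \<Rightarrow> nat \<Rightarrow> nat \<Rightarrow> complex mat set" where
  "mats_over F n k = {A \<in> carrier_mat n k. elements_mat A \<subseteq> F}"

definition vecs_over :: "complex set \<Rightarrow> nat \<Rightarrow> complex vec set" where
  "vecs_over F n = {v \<in> carrier_vec n. set\<^sub>v v \<subseteq> F}"

text \<open>\<open>v \<bullet>c v\<close> is \<open>v\<^sup>* v\<close>.\<close>

definition unit_vec_over :: "complex set \<Rightarrow> nat \<Rightarrow> complex vec \<Rightarrow> bool" where
  "unit_vec_over F n v \<longleftrightarrow> v \<in> vecs_over F n \<and> v \<bullet>c v = 1"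

text \<open>
  The \<open>m \<times> mg\<close> matrix \<open>L = (L\<^sub>0, \<dots>, L\<^sub>g\<^sub>-\<^sub>1)\<close> of consecutive square blocks stands for
  \<open>L\<^sub>0 + L\<^sub>1 z\<^sup>-\<^sup>1 + \<dots>\<close>.
\<close>

definition blocks_to_lmat :: "nat \<Rightarrow> nat \<Rightarrow> complex mat \<Rightarrow> laurent mat" where
  "blocks_to_lmat m g L =
     mat m m (\<lambda>(i, j). \<Sum>k<g. Poly_Mapping.single (- int k) (L $$ (i, k * m + j)))"

definition biorthogonal_wavelet_pair :: "nat \<Rightarrow> nat \<Rightarrow> complex mat \<Rightarrow> complex mat \<Rightarrow> bool" where
  "biorthogonal_wavelet_pair m g L R \<longleftrightarrow>
     blocks_to_lmat m g L * lmat_adjoint (blocks_to_lmat m g R) = of_nat m \<cdot>\<^sub>m 1\<^sub>m m \<and>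
     (\<forall>i<m. (\<Sum>j<m * g. L $$ (i, j)) = (if i = 0 then of_nat m else 0) \<and>
            (\<Sum>j<m * g. R $$ (i, j)) = (if i = 0 then of_nat m else 0))"

definition outer_self :: "complex vec \<Rightarrow> complex mat" where
  "outer_self v = mat (dim_vec v) (dim_vec v) (\<lambda>(i, j). v $ i * cnj (v $ j))"

definition primitive_paraunitary :: "complex set \<Rightarrow> nat \<Rightarrow> laurent mat \<Rightarrow> bool" where
  "primitive_paraunitary F m V \<longleftrightarrow>
     (\<exists>v. unit_vec_over F m v \<and>
        V = 1\<^sub>m m - const_lmat (outer_self v) + zpow (- 1) \<cdot>\<^sub>m const_lmat (outer_self v))"

definition lift_L :: "nat \<Rightarrow> complex mat \<Rightarrow> nat \<Rightarrow> laurent mat" where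
  "lift_L m N k = 1\<^sub>m m - const_lmat N + zpow (- int k) \<cdot>\<^sub>m const_lmat N"

definition lift_R :: "nat \<Rightarrow> complex mat \<Rightarrow> nat \<Rightarrow> laurent mat" where
  "lift_R m N k =
     1\<^sub>m m + const_lmat (mat_adjoint N) - zpow (int k) \<cdot>\<^sub>m const_lmat (mat_adjoint N)"

definition haar :: "nat \<Rightarrow> complex mat" where
  "haar m = mat m m (\<lambda>(i, j).
     if i = 0 then 1
     else let s = real (m - i); a = sqrt (real m / (s\<^sup>2 + s)) in
       if j < i - 1 then 0
       else if j = i - 1 then complex_of_real (- s * a)
       else complex_of_real a)"

definition diag_one :: "nat \<Rightarrow> complex mat \<Rightarrow> complex mat" where
  "diag_one m G = four_block_mat (1\<^sub>m 1) (0\<^sub>m 1 (m - 1)) (0\<^sub>m (m - 1) 1) G"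

text \<open>
  The conditions under which the canonical Haar matrix is a matrix over \<open>F\<close> and every nonzero
  vector over \<open>F\<close> is proportional to a unit vector over \<open>F\<close>. They hold for instance if \<open>F\<close> is
  closed under square roots of its nonnegative real elements, but not for every subfield, and
  neither can be dropped from the factorization of a pair over \<open>F\<close>:

  \<^item> For \<open>F = \<rat>\<close> and \<open>m = 3\<close>, let \<open>L\<close> be the constant matrix with rows \<open>(1, 1, 1)\<close>, \<open>(1, -1, 0)\<close>,
    \<open>(0, 1, -1)\<close>, and \<open>R = 3 (L\<^sup>*)\<^sup>-\<^sup>1\<close>. A factorization evaluated at \<open>z = 1\<close> gives
    \<open>L = diag (1, G) H\<close>, hence \<open>1 = - G\<^sub>0\<^sub>0 sqrt 2\<close> with \<open>G\<close> rational.
  \<^item> For \<open>F = \<rat>\<close> and \<open>m = 2\<close>, where \<open>H\<close> is rational, let \<open>L(z) = R(z) = (I - P + P z\<^sup>-\<^sup>1) H\<close> with \<open>P\<close>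
    the orthogonal projection onto the line of \<open>(1, 1)\<close>, which contains no rational unit vector.
\<close>

definition haar_over :: "complex set \<Rightarrow> nat \<Rightarrow> bool" where
  "haar_over F m \<longleftrightarrow> haar m \<in> mats_over F m m"

definition normalizable_over :: "complex set \<Rightarrow> nat \<Rightarrow> bool" where
  "normalizable_over F m \<longleftrightarrow>
     (\<forall>v\<in>vecs_over F m. v \<noteq> 0\<^sub>v m \<longrightarrow> (\<exists>c\<in>F. unit_vec_over F m (c \<cdot>\<^sub>v v)))"

end

theory Submission
  imports Defs
begin

text \<open>
  Put \<open>w = z\<^sup>-\<^sup>1\<close>. The pair relation makes \<open>L\<close> a matrix over \<open>F[w]\<close> whose determinant divides a monomial,
  so \<open>det L = c w\<^sup>b\<close>. While \<open>b > 0\<close>, the matrix \<open>L(w = 0)\<close> has a left kernel vector over \<open>F\<close>; its unit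
  multiple gives a primitive factor that splits off on the left without raising the degree. This takes
  \<open>b\<close> steps, so \<open>k\<^sub>0 = 0\<close> and \<open>d = b\<close> always work.

  What remains is unimodular over \<open>F[w]\<close>. As long as it is not constant, its matrix of leading row
  coefficients is singular, and a linear relation between the rows of the latter lowers a row degree of the
  former by elementary row operations. An elementary matrix \<open>I + a w\<^sup>k E\<^sub>i\<^sub>j\<close> with \<open>k > 0\<close> is
  \<open>(I - N + N w\<^sup>k) (I + N)\<close> with \<open>N = a E\<^sub>i\<^sub>j\<close>, and constant factors move to the right past
  lifting factors by conjugating \<open>N\<close>. So the unimodular part is a product of lifting factors times a
  constant matrix.

  At \<open>z = 1\<close> all factors except the constant one become the identity, so the constant is \<open>L(1)\<close>, and
  the row sums force \<open>L(1) H\<^sup>*/m\<close> to be \<open>diag (1, G)\<close>. Finally \<open>R\<close> is determined by \<open>L\<close>.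
\<close>

section \<open>Matrices over a subfield\<close>

text \<open>The genus bound cannot be read off the single lifting factors: their number and their
  exponents are uncontrolled, and high powers may cancel in the product. It comes from the order of
  the two reductions. The primitive factors are removed first, with entry degrees staying at most
  \<open>g - 1\<close>. The unimodular matrix left over is \<open>C\<close> times an invertible
  constant, so \<open>C\<close> obeys the same degree bound, whatever the row reduction did.

  Since \<open>F\<close> need not be algebraically closed, every choice has to be made over
  \<open>F\<close>: kernel vectors are found by elimination over \<open>F\<close>,
  \<open>normalizable_over\<close> turns one into a unit vector over \<open>F\<close>, and
  \<open>haar_over\<close> puts \<open>G\<close> over \<open>F\<close>.

  The reductions take place in the polynomial ring in \<open>w\<close>, where degrees and
  divisibility by the variable drive the inductions. A ring homomorphism carries the resulting
  factorization to Laurent polynomials, and its injectivity lets the pair relation be used in the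
  polynomial ring.\<close>

lemma mats_over_iff:
  "A \<in> mats_over F n k \<longleftrightarrow> A \<in> carrier_mat n k \<and> (\<forall>i<n. \<forall>j<k. A $$ (i, j) \<in> F)"
  unfolding mats_over_def by (fastforce dest: elements_matD)

lemma mats_over_carrier: "A \<in> mats_over F n k \<Longrightarrow> A \<in> carrier_mat n k"
  by (simp add: mats_over_iff)

lemma index_mult_sum:
  "A \<in> carrier_mat n k \<Longrightarrow> B \<in> carrier_mat k l \<Longrightarrow> i < n \<Longrightarrow> j < l \<Longrightarrow>
    (A * B) $$ (i, j) = (\<Sum>s<k. A $$ (i, s) * B $$ (s, j))"
  by (simp add: scalar_prod_def atLeast0LessThan)

lemma mat_adjoint_carrier: "A \<in> carrier_mat n k \<Longrightarrow> mat_adjoint A \<in> carrier_mat k n"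
  unfolding mat_adjoint_def by auto

lemma mat_adjoint_index:
  fixes A :: "complex mat"
  assumes "A \<in> carrier_mat n k" "i < k" "j < n"
  shows "mat_adjoint A $$ (i, j) = cnj (A $$ (j, i))"
  using assms unfolding mat_adjoint_def by (simp add: mat_of_rows_def)

locale conj_closed_subfield =
  fixes F :: "complex set"
  assumes subfield: "conj_subfield F"
begin

lemma zero_in [simp]: "0 \<in> F" and one_in [simp]: "1 \<in> F"
  and add_in [simp]: "x \<in> F \<Longrightarrow> y \<in> F \<Longrightarrow> x + y \<in> F"
  and mult_in [simp]: "x \<in> F \<Longrightarrow> y \<in> F \<Longrightarrow> x * y \<in> F"
  and uminus_in [simp]: "x \<in> F \<Longrightarrow> - x \<in> F"
  and inverse_in [simp]: "x \<in> F \<Longrightarrow> inverse x \<in> F"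
  and cnj_in [simp]: "x \<in> F \<Longrightarrow> cnj x \<in> F"
  using subfield unfolding conj_subfield_def by auto

lemma diff_in [simp]: "x \<in> F \<Longrightarrow> y \<in> F \<Longrightarrow> x - y \<in> F"
  using add_in[of x "- y"] by simp

lemma divide_in [simp]: "x \<in> F \<Longrightarrow> y \<in> F \<Longrightarrow> x / y \<in> F"
  by (simp add: divide_inverse)

lemma of_nat_in [simp]: "of_nat n \<in> F"
  by (induction n) auto

lemma power_in [simp]: "x \<in> F \<Longrightarrow> x ^ n \<in> F"
  by (induction n) auto

lemma sum_in: "(\<And>i. i \<in> I \<Longrightarrow> f i \<in> F) \<Longrightarrow> sum f I \<in> F"
  by (induction I rule: infinite_finite_induct) auto

lemma prod_in: "(\<And>i. i \<in> I \<Longrightarrow> f i \<in> F) \<Longrightarrow> prod f I \<in> F"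
  by (induction I rule: infinite_finite_induct) auto

lemma mult_mats_over:
  "A \<in> mats_over F n k \<Longrightarrow> B \<in> mats_over F k l \<Longrightarrow> A * B \<in> mats_over F n l"
  by (auto simp: mats_over_iff scalar_prod_def intro!: sum_in)

lemma smult_mats_over: "a \<in> F \<Longrightarrow> A \<in> mats_over F n k \<Longrightarrow> a \<cdot>\<^sub>m A \<in> mats_over F n k"
  by (auto simp: mats_over_iff)

lemma mat_adjoint_mats_over: "A \<in> mats_over F n k \<Longrightarrow> mat_adjoint A \<in> mats_over F k n"
  unfolding mats_over_iff using mat_adjoint_carrier mat_adjoint_index by auto

lemma det_in: "A \<in> mats_over F n n \<Longrightarrow> det A \<in> F"
proof -
  assume A: "A \<in> mats_over F n n"
  have "signof p \<in> F" for p
    using signof_pm_one[of p] by (metis empty_iff insert_iff one_in uminus_in)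
  moreover have "A $$ (i, p i) \<in> F" if "p permutes {0..<n}" "i < n" for p i
    using that permutes_in_image[OF that(1), of i] A by (auto simp: mats_over_iff)
  ultimately show "det A \<in> F"
    using A by (auto simp: det_def'[OF mats_over_carrier[OF A]] intro!: sum_in mult_in prod_in)
qed

text \<open>By Cramer's rule: the cofactors are up to sign determinants of matrices over
  \<open>F\<close>, so inversion does not leave \<open>F\<close>.\<close>

lemma exists_inverse_over:
  assumes A: "A \<in> mats_over F n n" and "det A \<noteq> 0"
  obtains B where "B \<in> mats_over F n n" "A * B = 1\<^sub>m n" "B * A = 1\<^sub>m n"
proof
  have c: "A \<in> carrier_mat n n" using A by (rule mats_over_carrier)
  let ?B = "inverse (det A) \<cdot>\<^sub>m adj_mat A"
  have "cofactor A j i \<in> F" if "i < n" "j < n" for i j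
  proof -
    have "mat_delete A j i \<in> mats_over F (n - 1) (n - 1)"
      using A that unfolding mats_over_iff mat_delete_def by auto
    then show ?thesis unfolding cofactor_def by (simp add: det_in)
  qed
  then have "adj_mat A \<in> mats_over F n n"
    using c unfolding mats_over_iff adj_mat_def by auto
  then show "?B \<in> mats_over F n n" using det_in[OF A] by (simp add: smult_mats_over)
  show "A * ?B = 1\<^sub>m n"
    using adj_mat[OF c] \<open>det A \<noteq> 0\<close> c by (subst mult_smult_distrib[OF c]) auto
  show "?B * A = 1\<^sub>m n"
    using adj_mat[OF c] \<open>det A \<noteq> 0\<close> c by (subst mult_smult_assoc_mat[of _ n n]) auto
qed

text \<open>Gaussian elimination, pivoting on one coordinate at a time.\<close>

lemma linear_dependence_over:
  fixes v :: "'i \<Rightarrow> 'k \<Rightarrow> complex"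
  assumes "finite K" and "finite I" and "\<And>i k. i \<in> I \<Longrightarrow> k \<in> K \<Longrightarrow> v i k \<in> F"
    and "\<exists>i\<in>I. \<alpha> i \<noteq> 0" and "\<And>k. k \<in> K \<Longrightarrow> (\<Sum>i\<in>I. \<alpha> i * v i k) = 0"
  shows "\<exists>\<beta>. (\<forall>i\<in>I. \<beta> i \<in> F) \<and> (\<exists>i\<in>I. \<beta> i \<noteq> 0) \<and> (\<forall>k\<in>K. (\<Sum>i\<in>I. \<beta> i * v i k) = 0)"
  using assms
proof (induction K arbitrary: I v rule: finite_induct)
  case empty
  then show ?case by (intro exI[of _ "\<lambda>_. 1"]) auto
next
  case (insert k K)
  show ?case
  proof (cases "\<forall>i\<in>I. v i k = 0")
    case True
    have "\<exists>\<beta>. (\<forall>i\<in>I. \<beta> i \<in> F) \<and> (\<exists>i\<in>I. \<beta> i \<noteq> 0) \<and> (\<forall>k\<in>K. (\<Sum>i\<in>I. \<beta> i * v i k) = 0)"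
      by (rule insert.IH) (use insert.prems in auto)
    with True show ?thesis by auto
  next
    case False
    then obtain p where p: "p \<in> I" "v p k \<noteq> 0" by blast
    define J where "J = I - {p}"
    define q where "q i = v i k / v p k" for i
    define v' where "v' i l = v i l - q i * v p l" for i l
    have split: "(\<Sum>i\<in>I. h i) = h p + (\<Sum>i\<in>J. h i)" for h :: "'i \<Rightarrow> complex"
      using p insert.prems(1) unfolding J_def by (simp add: sum.remove)
    have elim: "(\<Sum>i\<in>J. \<beta> i * v' i l) = (\<Sum>i\<in>J. \<beta> i * v i l) - (\<Sum>i\<in>J. \<beta> i * q i) * v p l"
      for \<beta> l
      by (simp add: v'_def algebra_simps sum_subtractf sum_distrib_left)
    \<comment> \<open>Coordinate \<open>k\<close> expresses \<open>\<alpha> p\<close> through the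
      other coefficients. Hence the restriction of \<open>\<alpha>\<close> to \<open>J\<close> is a
      relation between the reduced vectors \<open>v'\<close>, and it is nonzero because
      \<open>\<alpha> p\<close> would vanish along with it.\<close>
    have pivot: "(\<Sum>i\<in>J. \<alpha> i * q i) = - \<alpha> p"
    proof -
      have "(\<Sum>i\<in>J. \<alpha> i * q i) = (\<Sum>i\<in>J. \<alpha> i * v i k) / v p k"
        by (simp add: q_def sum_divide_distrib)
      moreover have "(\<Sum>i\<in>J. \<alpha> i * v i k) = - \<alpha> p * v p k"
        using insert.prems(4)[of k] split[of "\<lambda>i. \<alpha> i * v i k"] by (simp add: eq_neg_iff_add_eq_0 add.commute)
      ultimately show ?thesis using p by simp
    qed
    have qF: "q i \<in> F" if "i \<in> I" for i
      using that insert.prems(2) p unfolding q_def by simp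
    have "\<exists>\<beta>. (\<forall>i\<in>J. \<beta> i \<in> F) \<and> (\<exists>i\<in>J. \<beta> i \<noteq> 0) \<and> (\<forall>l\<in>K. (\<Sum>i\<in>J. \<beta> i * v' i l) = 0)"
    proof (rule insert.IH)
      show "finite J" using insert.prems unfolding J_def by simp
      show "v' i l \<in> F" if "i \<in> J" "l \<in> K" for i l
        using that insert.prems(2) p qF unfolding v'_def J_def by simp
      show "\<exists>i\<in>J. \<alpha> i \<noteq> 0"
      proof (rule ccontr)
        assume zero: "\<not> ?thesis"
        then have "\<alpha> p = 0" using pivot by simp
        with zero insert.prems(3) show False unfolding J_def by auto
      qed
      show "(\<Sum>i\<in>J. \<alpha> i * v' i l) = 0" if "l \<in> K" for l
        using insert.prems(4)[of l] that split[of "\<lambda>i. \<alpha> i * v i l"] unfolding elim pivot by (simp add: add.commute)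
    qed
    then obtain \<beta> where \<beta>: "\<And>i. i \<in> J \<Longrightarrow> \<beta> i \<in> F" "\<exists>i\<in>J. \<beta> i \<noteq> 0"
      "\<And>l. l \<in> K \<Longrightarrow> (\<Sum>i\<in>J. \<beta> i * v' i l) = 0" by blast
    \<comment> \<open>The value at the pivot is the one that coordinate \<open>k\<close>
      forces.\<close>
    define \<gamma> where "\<gamma> = \<beta>(p := - (\<Sum>i\<in>J. \<beta> i * q i))"
    have sumJ: "(\<Sum>i\<in>J. \<gamma> i * v i l) = (\<Sum>i\<in>J. \<beta> i * v i l)" for l
      by (rule sum.cong) (auto simp: \<gamma>_def J_def)
    have "\<gamma> i \<in> F" if "i \<in> I" for i
      using that \<beta>(1) qF unfolding \<gamma>_def J_def by (auto intro!: uminus_in sum_in mult_in)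
    moreover have "\<exists>i\<in>I. \<gamma> i \<noteq> 0"
      using \<beta>(2) unfolding \<gamma>_def J_def by auto
    moreover have "(\<Sum>i\<in>I. \<gamma> i * v i l) = 0" if "l \<in> insert k K" for l
    proof (cases "l = k")
      case True
      have "(\<Sum>i\<in>J. \<beta> i * q i) * v p k = (\<Sum>i\<in>J. \<beta> i * v i k)"
        using p by (simp add: q_def sum_distrib_right)
      then show ?thesis
        unfolding split sumJ True by (simp add: \<gamma>_def)
    next
      case False
      then show ?thesis
        using \<beta>(3)[of l] that elim[of \<beta> l] unfolding split sumJ by (simp add: \<gamma>_def)
    qed
    ultimately show ?thesis by blast
  qed
qed

text \<open>Singularity yields a complex kernel vector of the transpose. As the entries lie in
  \<open>F\<close>, the relation between the rows that it encodes descends to one with coefficients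
  in \<open>F\<close>.\<close>

lemma left_kernel_over:
  assumes A: "A \<in> mats_over F n n" and "det A = 0"
  obtains \<beta> where "\<And>i. i < n \<Longrightarrow> \<beta> i \<in> F" "\<exists>i<n. \<beta> i \<noteq> 0"
    "\<And>j. j < n \<Longrightarrow> (\<Sum>i<n. \<beta> i * A $$ (i, j)) = 0"
proof -
  have c: "A \<in> carrier_mat n n" using A by (rule mats_over_carrier)
  have "det (transpose_mat A) = 0" using assms det_transpose[OF c] by simp
  then obtain v where v: "v \<in> carrier_vec n" "v \<noteq> 0\<^sub>v n" "transpose_mat A *\<^sub>v v = 0\<^sub>v n"
    using det_0_iff_vec_prod_zero[of "transpose_mat A" n] c by auto
  have "(\<Sum>i<n. v $ i * A $$ (i, j)) = 0" if "j < n" for j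
  proof -
    have "(transpose_mat A *\<^sub>v v) $ j = 0" using v that by simp
    then show ?thesis using c v(1) that
      by (simp add: scalar_prod_def atLeast0LessThan mult.commute)
  qed
  moreover have "\<exists>i<n. v $ i \<noteq> 0" using v by (metis carrier_vecD eq_vecI index_zero_vec)
  ultimately have "\<exists>\<beta>. (\<forall>i\<in>{..<n}. \<beta> i \<in> F) \<and> (\<exists>i\<in>{..<n}. \<beta> i \<noteq> 0) \<and>
      (\<forall>j\<in>{..<n}. (\<Sum>i<n. \<beta> i * A $$ (i, j)) = 0)"
    using A by (intro linear_dependence_over[of _ _ _ "\<lambda>i. v $ i"]) (auto simp: mats_over_iff)
  then show thesis using that by blast
qed

end

section \<open>Polynomial matrices and lifting factors\<close>

interpretation const_poly_hom: inj_comm_ring_hom "\<lambda>a :: 'a :: comm_ring_1. [:a:]"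
  by unfold_locales (auto simp: one_pCons)

text \<open>Evaluation at \<open>w = 0\<close>. It commutes with \<open>det\<close>, so a
  determinant divisible by \<open>w\<close> makes the matrix of constant coefficients
  singular.\<close>

interpretation coeff_0_hom: comm_ring_hom "\<lambda>p :: 'a :: comm_ring_1 poly. coeff p 0"
  by unfold_locales (auto simp: coeff_mult)

abbreviation const_pmat :: "complex mat \<Rightarrow> complex poly mat" where
  "const_pmat \<equiv> map_mat (\<lambda>a. [:a:])"

text \<open>The lifting factor in the variable \<open>w = z\<^sup>-\<^sup>1\<close>. For
  \<open>N = v v\<^sup>*\<close> and \<open>k = 1\<close> it is a primitive paraunitary factor, so
  both kinds of factor share this definition.\<close>

definition poly_lift :: "nat \<Rightarrow> complex mat \<Rightarrow> nat \<Rightarrow> complex poly mat" where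
  "poly_lift m N k = 1\<^sub>m m - const_pmat N + monom 1 k \<cdot>\<^sub>m const_pmat N"

lemma one_plus_mult:
  fixes N A :: "'a :: comm_ring_1 mat"
  assumes N: "N \<in> carrier_mat m m" and A: "A \<in> carrier_mat m l"
  shows "(1\<^sub>m m + s \<cdot>\<^sub>m N) * A = A + s \<cdot>\<^sub>m (N * A)"
proof -
  have "(1\<^sub>m m + s \<cdot>\<^sub>m N) * A = 1\<^sub>m m * A + (s \<cdot>\<^sub>m N) * A"
    using N A by (intro add_mult_distrib_mat[of _ m m]) auto
  then show ?thesis using mult_smult_assoc_mat[OF N A] A by simp
qed

lemma mult_one_plus:
  fixes N A :: "'a :: comm_ring_1 mat"
  assumes N: "N \<in> carrier_mat m m" and A: "A \<in> carrier_mat l m"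
  shows "A * (1\<^sub>m m + s \<cdot>\<^sub>m N) = A + s \<cdot>\<^sub>m (A * N)"
proof -
  have "A * (1\<^sub>m m + s \<cdot>\<^sub>m N) = A * 1\<^sub>m m + A * (s \<cdot>\<^sub>m N)"
    using N A by (intro mult_add_distrib_mat[of _ l m]) auto
  then show ?thesis using mult_smult_distrib[OF A N] A by simp
qed

text \<open>The case \<open>c = 0\<close> covers the nilpotent matrices of the lifting factors, the
  case \<open>c = 1\<close> the projections of the primitive factors.\<close>

lemma one_plus_mult_one_plus:
  fixes N :: "'a :: comm_ring_1 mat"
  assumes N: "N \<in> carrier_mat m m" and NN: "N * N = c \<cdot>\<^sub>m N"
  shows "(1\<^sub>m m + s \<cdot>\<^sub>m N) * (1\<^sub>m m + t \<cdot>\<^sub>m N) = 1\<^sub>m m + (s + t + s * t * c) \<cdot>\<^sub>m N"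
proof -
  have "(1\<^sub>m m + s \<cdot>\<^sub>m N) * (1\<^sub>m m + t \<cdot>\<^sub>m N) =
      (1\<^sub>m m + t \<cdot>\<^sub>m N) + s \<cdot>\<^sub>m (N + t \<cdot>\<^sub>m (N * N))"
    using N by (subst one_plus_mult[of _ _ _ m]) (auto simp: mult_one_plus)
  then show ?thesis
    unfolding NN using N by (auto intro!: eq_matI simp: algebra_simps)
qed

lemma poly_lift_eq:
  "N \<in> carrier_mat m m \<Longrightarrow> poly_lift m N k = 1\<^sub>m m + (monom 1 k - 1) \<cdot>\<^sub>m const_pmat N"
  unfolding poly_lift_def by (intro eq_matI) (auto simp: algebra_simps)

lemma poly_lift_carrier: "N \<in> carrier_mat m m \<Longrightarrow> poly_lift m N k \<in> carrier_mat m m"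
  by (simp add: poly_lift_def)

text \<open>Moves a constant to the right past a lifting factor. As \<open>S\<close> inverts
  \<open>T\<close>, conjugation fixes the identity part and replaces \<open>N\<close> by its
  conjugate.\<close>

lemma poly_lift_similar:
  assumes T: "T \<in> carrier_mat m m" and S: "S \<in> carrier_mat m m" and ST: "S * T = 1\<^sub>m m"
    and N: "N \<in> carrier_mat m m" and A: "A \<in> carrier_mat m m"
  shows "const_pmat T * (poly_lift m N k * A) = poly_lift m (T * N * S) k * (const_pmat T * A)"
proof -
  let ?s = "monom 1 k - 1 :: complex poly"
  have c: "const_pmat T \<in> carrier_mat m m" "const_pmat N \<in> carrier_mat m m"
    "const_pmat (T * N * S) \<in> carrier_mat m m" "const_pmat T * A \<in> carrier_mat m m"
    "const_pmat N * A \<in> carrier_mat m m"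
    using T S N A by auto
  have TNS: "T * N * S \<in> carrier_mat m m" using T N S by simp
  have "T * N * S * T = T * N"
    using T S N ST by (simp add: assoc_mult_mat[of _ m m _ m _ m])
  then have conj: "const_pmat (T * N * S) * const_pmat T = const_pmat T * const_pmat N"
    using T S N by (simp flip: const_poly_hom.mat_hom_mult[of _ m m _ m])
  have "poly_lift m (T * N * S) k * (const_pmat T * A) =
      const_pmat T * A + ?s \<cdot>\<^sub>m (const_pmat (T * N * S) * (const_pmat T * A))"
    by (simp only: poly_lift_eq[OF TNS] one_plus_mult[OF c(3,4)])
  also have "const_pmat (T * N * S) * (const_pmat T * A) = const_pmat T * (const_pmat N * A)"
    using assoc_mult_mat[OF c(3,1) A] assoc_mult_mat[OF c(1,2) A] by (simp add: conj)
  also have "const_pmat T * A + ?s \<cdot>\<^sub>m \<dots> = const_pmat T * (A + ?s \<cdot>\<^sub>m (const_pmat N * A))"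
    using mult_add_distrib_mat[OF c(1) A, of "?s \<cdot>\<^sub>m (const_pmat N * A)"]
      mult_smult_distrib[OF c(1,5)] c by simp
  also have "A + ?s \<cdot>\<^sub>m (const_pmat N * A) = poly_lift m N k * A"
    using N by (simp add: poly_lift_eq one_plus_mult[OF c(2) A])
  finally show ?thesis by simp
qed

section \<open>Row degree bounds and the top coefficient of a determinant\<close>

lemma coeff_mult_sum:
  fixes p q :: "'a :: comm_ring_1 poly"
  assumes "degree p \<le> a" and "degree q \<le> b"
  shows "coeff (p * q) (a + b) = coeff p a * coeff q b"
proof (cases "degree p = a \<and> degree q = b")
  case True
  then show ?thesis using coeff_mult_degree_sum[of p q] by auto
next
  case False
  then have "degree (p * q) < a + b" using assms degree_mult_le[of p q] by linarith
  moreover have "coeff p a = 0 \<or> coeff q b = 0" using False assms by (auto intro: coeff_eq_0)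
  ultimately show ?thesis by (auto simp: coeff_eq_0)
qed

lemma coeff_prod_sum:
  fixes p :: "'i \<Rightarrow> 'a :: comm_ring_1 poly"
  assumes "finite I" and "\<And>i. i \<in> I \<Longrightarrow> degree (p i) \<le> d i"
  shows "degree (\<Prod>i\<in>I. p i) \<le> (\<Sum>i\<in>I. d i) \<and>
    coeff (\<Prod>i\<in>I. p i) (\<Sum>i\<in>I. d i) = (\<Prod>i\<in>I. coeff (p i) (d i))"
  using assms
proof (induction I rule: finite_induct)
  case (insert i I)
  then have "degree (p i * (\<Prod>i\<in>I. p i)) \<le> d i + (\<Sum>i\<in>I. d i)"
    by (intro order.trans[OF degree_mult_le]) (simp add: add_mono)
  moreover have "coeff (p i * (\<Prod>i\<in>I. p i)) (d i + (\<Sum>i\<in>I. d i)) =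
      coeff (p i) (d i) * coeff (\<Prod>i\<in>I. p i) (\<Sum>i\<in>I. d i)"
    using insert by (intro coeff_mult_sum) auto
  ultimately show ?case using insert by simp
qed simp

text \<open>Each product in the Leibniz expansion takes exactly one entry from every row, so its
  degree is at most the sum of the bounds, and its coefficient there is the product of the entries
  of \<open>M\<close>. The numbers \<open>d i\<close> are only upper bounds; \<open>M\<close> may
  even have zero rows.\<close>

lemma coeff_det_row_degrees:
  fixes C :: "'a :: comm_ring_1 poly mat" and d :: "nat \<Rightarrow> nat"
  assumes C: "C \<in> carrier_mat m m"
    and deg: "\<And>i j. i < m \<Longrightarrow> j < m \<Longrightarrow> degree (C $$ (i, j)) \<le> d i"
  defines "M \<equiv> mat m m (\<lambda>(i, j). coeff (C $$ (i, j)) (d i))"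
  shows "coeff (det C) (\<Sum>i<m. d i) = det M"
proof -
  have "coeff (signof p * (\<Prod>i = 0..<m. C $$ (i, p i))) (\<Sum>i<m. d i) =
      signof p * (\<Prod>i = 0..<m. coeff (C $$ (i, p i)) (d i))" if p: "p permutes {0..<m}" for p
  proof -
    have "p i < m" if "i < m" for i using permutes_in_image[OF p, of i] that by simp
    then have "coeff (\<Prod>i = 0..<m. C $$ (i, p i)) (\<Sum>i<m. d i) =
        (\<Prod>i = 0..<m. coeff (C $$ (i, p i)) (d i))"
      using coeff_prod_sum[of "{0..<m}" "\<lambda>i. C $$ (i, p i)" d] deg by (simp add: atLeast0LessThan)
    moreover have "sign p = 1 \<or> sign p = -1" by (simp add: sign_def)
    ultimately show ?thesis by (elim disjE) simp_all
  qed
  moreover have "(\<Prod>i = 0..<m. coeff (C $$ (i, p i)) (d i)) = (\<Prod>i = 0..<m. M $$ (i, p i))"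
    if p: "p permutes {0..<m}" for p
    using permutes_in_image[OF p] by (intro prod.cong) (auto simp: M_def)
  ultimately have "(\<Sum>p | p permutes {0..<m}. coeff (signof p * (\<Prod>i = 0..<m. C $$ (i, p i))) (\<Sum>i<m. d i)) =
      (\<Sum>p | p permutes {0..<m}. signof p * (\<Prod>i = 0..<m. M $$ (i, p i)))"
    by (intro sum.cong) auto
  moreover have "M \<in> carrier_mat m m" by (simp add: M_def)
  ultimately show "coeff (det C) (\<Sum>i<m. d i) = det M"
    by (simp only: det_def'[OF C] det_def' coeff_sum)
qed

section \<open>Row reduction of unimodular matrices to lifting factors\<close>

context conj_closed_subfield
begin

text \<open>The single constant factor stands rightmost, the shape that the theorem asks for. The
  closure properties that undo row operations, under constants and elementary matrices on the left,
  are proved rather than built in.\<close>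

inductive_set lift_products :: "nat \<Rightarrow> complex poly mat set" for m where
  const: "S \<in> mats_over F m m \<Longrightarrow> T \<in> mats_over F m m \<Longrightarrow> S * T = 1\<^sub>m m \<Longrightarrow> T * S = 1\<^sub>m m \<Longrightarrow>
    const_pmat S \<in> lift_products m"
| lift: "N \<in> mats_over F m m \<Longrightarrow> N * N = 0\<^sub>m m m \<Longrightarrow> k > 0 \<Longrightarrow> A \<in> lift_products m \<Longrightarrow>
    poly_lift m N k * A \<in> lift_products m"

lemma lift_products_carrier: "A \<in> lift_products m \<Longrightarrow> A \<in> carrier_mat m m"
  by (induction rule: lift_products.induct) (auto simp: mats_over_iff intro: mult_carrier_mat poly_lift_carrier)

lemma const_mult_lift_products:
  assumes T: "T \<in> mats_over F m m" and S: "S \<in> mats_over F m m"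
    and TS: "T * S = 1\<^sub>m m" and ST: "S * T = 1\<^sub>m m" and "A \<in> lift_products m"
  shows "const_pmat T * A \<in> lift_products m"
  using assms(5)
proof (induction rule: lift_products.induct)
  have c: "T \<in> carrier_mat m m" "S \<in> carrier_mat m m" using T S by (auto simp: mats_over_iff)
  {
    case (const A B)
    then have AB: "A \<in> carrier_mat m m" "B \<in> carrier_mat m m" by (auto simp: mats_over_iff)
    have "(T * A) * (B * S) = T * (A * B) * S" "(B * S) * (T * A) = B * (S * T) * A"
      using c AB by (simp_all add: assoc_mult_mat[of _ m m _ m _ m])
    then have "(T * A) * (B * S) = 1\<^sub>m m" "(B * S) * (T * A) = 1\<^sub>m m"
      using const c AB TS ST by simp_all
    then have "const_pmat (T * A) \<in> lift_products m"
      using const T S by (intro lift_products.const[of _ _ "B * S"]) (auto intro: mult_mats_over)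
    then show ?case using c AB by (simp add: const_poly_hom.mat_hom_mult)
  next
    case (lift N k A)
    then have NA: "N \<in> carrier_mat m m" "A \<in> carrier_mat m m"
      by (auto simp: mats_over_iff lift_products_carrier)
    \<comment> \<open>The conjugate again squares to zero, because \<open>S * T\<close> cancels in
      the middle.\<close>
    have "(T * N * S) * (T * N * S) = T * N * (S * T) * N * S"
      using c NA by (simp add: assoc_mult_mat[of _ m m _ m _ m])
    also have "\<dots> = T * (N * N) * S"
      using c NA ST by (simp add: assoc_mult_mat[of _ m m _ m _ m])
    also have "\<dots> = 0\<^sub>m m m" using lift(2) c by simp
    finally have "(T * N * S) * (T * N * S) = 0\<^sub>m m m" .
    then show ?case
      unfolding poly_lift_similar[OF c ST NA] using lift T S
      by (intro lift_products.lift) (auto intro: mult_mats_over)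
  }
qed

text \<open>The exponent 0 is treated apart because lifting factors have positive exponents; there
  the row operation is itself an invertible constant.\<close>

lemma addrow_lift_products:
  assumes A: "A \<in> lift_products m" and "i < m" "j < m" "i \<noteq> j" and a: "a \<in> F"
  shows "addrow (monom a e) i j A \<in> lift_products m"
proof -
  define T where "T b = addrow_mat m b i j" for b :: complex
  have cT: "T b \<in> carrier_mat m m" for b by (simp add: T_def)
  have TF: "T b \<in> mats_over F m m" if "b \<in> F" for b
    using that cT[of b] by (auto simp: T_def mats_over_iff)
  have cA: "A \<in> carrier_mat m m" using A by (rule lift_products_carrier)
  have "T a * T (- a) = 1\<^sub>m m" "T (- a) * T a = 1\<^sub>m m"
    using addrow_mat_inv[of i m j a] addrow_mat_inv[of i m j "- a"] assms by (auto simp: T_def)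
  then have TA: "const_pmat (T a) * A \<in> lift_products m"
    using TF A a by (intro const_mult_lift_products[of _ _ "T (- a)"]) auto
  have eq: "addrow (monom a e) i j A = addrow_mat m (monom a e) i j * A"
    using cA assms by (intro addrow_mat) auto
  show ?thesis
  proof (cases "e = 0")
    case True
    have "addrow_mat m (monom a e) i j = const_pmat (T a)"
      unfolding T_def True by (intro eq_matI) (auto simp: monom_0)
    with TA show ?thesis by (simp add: eq)
  next
    case False
    define N where "N = mat m m (\<lambda>(x, y). if x = i \<and> y = j then a else 0)"
    have cN: "N \<in> carrier_mat m m" and NF: "N \<in> mats_over F m m"
      using a by (auto simp: N_def mats_over_iff)
    \<comment> \<open>A nonzero summand would need its middle index to equal both \<open>j\<close>
      and \<open>i\<close>.\<close>
    have "(N * N) $$ (x, y) = 0" if "x < m" "y < m" for x y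
      unfolding index_mult_sum[OF cN cN that] using that \<open>i \<noteq> j\<close>
      by (intro sum.neutral) (auto simp: N_def)
    then have NN: "N * N = 0\<^sub>m m m" using cN by (intro eq_matI) auto
    have cpN: "const_pmat N \<in> carrier_mat m m" using cN by simp
    have pNN: "const_pmat N * const_pmat N = 0 \<cdot>\<^sub>m const_pmat N"
      unfolding const_poly_hom.mat_hom_mult[OF cN cN, symmetric] NN using cN
      by (intro eq_matI) auto
    have "const_pmat (T a) = 1\<^sub>m m + 1 \<cdot>\<^sub>m const_pmat N"
      using assms unfolding T_def N_def by (intro eq_matI) auto
    \<comment> \<open>Here \<open>s = w\<^sup>e - 1\<close>, \<open>t = 1\<close> and
      \<open>c = 0\<close>, so that \<open>s + t + s t c\<close> is
      \<open>w\<^sup>e\<close>.\<close>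
    then have "poly_lift m N e * const_pmat (T a) = 1\<^sub>m m + monom 1 e \<cdot>\<^sub>m const_pmat N"
      unfolding poly_lift_eq[OF cN] by (simp add: one_plus_mult_one_plus[OF cpN pNN])
    also have "\<dots> = addrow_mat m (monom a e) i j"
      using assms unfolding N_def by (intro eq_matI) (auto simp: smult_monom)
    finally have "addrow (monom a e) i j A = poly_lift m N e * (const_pmat (T a) * A)"
      unfolding eq using assoc_mult_mat[of "poly_lift m N e" m m "const_pmat (T a)" m A m] cN cT cA
      by (simp add: poly_lift_carrier)
    moreover have "poly_lift m N e * (const_pmat (T a) * A) \<in> lift_products m"
      using TA NF NN False by (intro lift_products.lift) auto
    ultimately show ?thesis by simp
  qed
qed

text \<open>One multiple of a row is added at a time; the rows in \<open>J\<close> stay fixed since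
  \<open>i\<close> is not in \<open>J\<close>. Membership travels from the reduced matrix back to
  \<open>C\<close>, because each operation is undone by the one with the negated
  coefficient.\<close>

lemma row_operation_lift_products:
  fixes C :: "complex poly mat" and f :: "nat \<Rightarrow> complex" and e :: "nat \<Rightarrow> nat" and i m :: nat
  defines "C' \<equiv> \<lambda>J. mat m m (\<lambda>(x, y). C $$ (x, y) +
    (if x = i then \<Sum>j\<in>J. monom (f j) (e j) * C $$ (j, y) else 0))"
  assumes C: "C \<in> carrier_mat m m" and i: "i < m" and "J \<subseteq> {..<m} - {i}"
    and "\<And>j. j \<in> J \<Longrightarrow> f j \<in> F"
  shows "det (C' J) = det C \<and> (C' J \<in> lift_products m \<longrightarrow> C \<in> lift_products m)"
proof -
  have "finite J" by (rule finite_subset[OF assms(4)]) simp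
  then show ?thesis using assms(4,5)
  proof (induction J rule: finite_induct)
    case empty
    have "C' {} = C" using C unfolding C'_def by (intro eq_matI) auto
    then show ?case by simp
  next
    case (insert j J)
    then have j: "j < m" "i \<noteq> j" "f j \<in> F" by auto
    have cC': "C' J \<in> carrier_mat m m" for J by (simp add: C'_def)
    have step: "C' (insert j J) = addrow (monom (f j) (e j)) i j (C' J)"
      using insert(1,2) j i unfolding C'_def by (intro eq_matI) (auto simp: algebra_simps)
    have undo: "C' J = addrow (monom (- f j) (e j)) i j (C' (insert j J))"
      unfolding step using j i cC'[of J]
      by (intro eq_matI) (auto simp: distrib_left add_monom simp flip: mult.assoc distrib_right add.assoc)
    have "C' J \<in> lift_products m" if "C' (insert j J) \<in> lift_products m"
      using addrow_lift_products[OF that i j(1,2), of "- f j" "e j"] j(3) by (simp flip: undo)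
    moreover have "det (C' (insert j J)) = det (C' J)"
      unfolding step using j cC' by (intro det_addrow) auto
    ultimately show ?case using insert by auto
  qed
qed

text \<open>Induction on the sum of the row degree bounds: each round lowers the bound of one row by
  1 and leaves the determinant alone, and at sum 0 the matrix is an invertible constant.\<close>

lemma unimodular_in_lift_products:
  assumes "C \<in> carrier_mat m m"
    and "\<And>i j k. i < m \<Longrightarrow> j < m \<Longrightarrow> coeff (C $$ (i, j)) k \<in> F"
    and "\<And>i j. i < m \<Longrightarrow> j < m \<Longrightarrow> degree (C $$ (i, j)) \<le> d i"
    and "det C = [:c:]" and "c \<noteq> 0"
  shows "C \<in> lift_products m"
  using assms(1-4)
proof (induction "\<Sum>i<m. d i" arbitrary: C d rule: less_induct)
  case less
  note C = less.prems(1) and CF = less.prems(2) and deg = less.prems(3) and det = less.prems(4)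
  define M where "M = mat m m (\<lambda>(i, j). coeff (C $$ (i, j)) (d i))"
  have MF: "M \<in> mats_over F m m" using CF by (auto simp: M_def mats_over_iff)
  have detM: "coeff (det C) (\<Sum>i<m. d i) = det M"
    unfolding M_def using C deg by (rule coeff_det_row_degrees)
  show ?case
  proof (cases "(\<Sum>i<m. d i) = 0")
    case True
    then have d0: "d i = 0" if "i < m" for i using that by simp
    have "C = const_pmat M"
    proof (rule eq_matI)
      fix i j assume "i < dim_row (const_pmat M)" "j < dim_col (const_pmat M)"
      then have ij: "i < m" "j < m" by (auto simp: M_def)
      then have "degree (C $$ (i, j)) = 0" using deg[of i j] d0 by simp
      then obtain a where "C $$ (i, j) = [:a:]" by (rule degree_eq_zeroE)
      then show "C $$ (i, j) = const_pmat M $$ (i, j)" using ij d0 by (simp add: M_def)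
    qed (use C in \<open>auto simp: M_def\<close>)
    moreover have "det M \<noteq> 0" using detM True det \<open>c \<noteq> 0\<close> by simp
    then obtain T where "T \<in> mats_over F m m" "M * T = 1\<^sub>m m" "T * M = 1\<^sub>m m"
      by (rule exists_inverse_over[OF MF])
    then have "const_pmat M \<in> lift_products m" by (rule lift_products.const[OF MF])
    ultimately show ?thesis by simp
  next
    case False
    \<comment> \<open>\<open>det M\<close> is the coefficient of the constant \<open>det C\<close>
      at a positive exponent.\<close>
    then have "det M = 0" using detM det by (cases "\<Sum>i<m. d i") auto
    then obtain \<beta> where \<beta>: "\<And>i. i < m \<Longrightarrow> \<beta> i \<in> F" "\<exists>i<m. \<beta> i \<noteq> 0"
      "\<And>j. j < m \<Longrightarrow> (\<Sum>i<m. \<beta> i * M $$ (i, j)) = 0"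
      by (rule left_kernel_over[OF MF]) blast
    define S where "S = {i. i < m \<and> \<beta> i \<noteq> 0}"
    have S: "finite S" "S \<noteq> {}" using \<beta>(2) by (auto simp: S_def)
    \<comment> \<open>The row to be reduced has the largest bound among the rows in the relation.
      This makes all exponents \<open>d i - d j\<close> genuine differences, and the other rows are
      shifted up to the degree of row \<open>i\<close>.\<close>
    have "Max (d ` S) \<in> d ` S" using S by (intro Max_in) auto
    then obtain i where "i \<in> S" and di: "d i = Max (d ` S)" by auto
    have dmax: "d j \<le> d i" if "j \<in> S" for j unfolding di using that S by (intro Max_ge) auto
    have i: "i < m" "\<beta> i \<noteq> 0" using \<open>i \<in> S\<close> by (auto simp: S_def)
    define J where "J = S - {i}"
    define f where "f j = \<beta> j / \<beta> i" for j
    define e where "e j = d i - d j" for j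
    define C' where "C' = mat m m (\<lambda>(x, y). C $$ (x, y) +
      (if x = i then \<Sum>j\<in>J. monom (f j) (e j) * C $$ (j, y) else 0))"
    have JS: "S = insert i J" "i \<notin> J" "finite J" "J \<subseteq> {..<m} - {i}"
      using \<open>i \<in> S\<close> S by (auto simp: J_def S_def)
    have Jm: "j < m" "d j \<le> d i" if "j \<in> J" for j using that dmax by (auto simp: J_def S_def)
    have fF: "f j \<in> F" if "j \<in> J" for j using that Jm \<beta>(1) i by (auto simp: f_def)
    have row_op: "det C' = det C" "C' \<in> lift_products m \<Longrightarrow> C \<in> lift_products m"
      using row_operation_lift_products[where f = f and e = e, OF C i(1) JS(4) fF] unfolding C'_def by blast+
    have C': "C' \<in> carrier_mat m m" by (simp add: C'_def)
    have row: "C' $$ (i, y) = C $$ (i, y) + (\<Sum>j\<in>J. monom (f j) (e j) * C $$ (j, y))" if "y < m" for y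
      using that i by (simp add: C'_def)
    have other: "C' $$ (x, y) = C $$ (x, y)" if "x < m" "y < m" "x \<noteq> i" for x y
      using that by (simp add: C'_def)
    have term_deg: "degree (monom (f j) (e j) * C $$ (j, y)) \<le> d i" if "j \<in> J" "y < m" for j y
    proof -
      have "degree (monom (f j) (e j) * C $$ (j, y)) \<le> e j + d j"
        using Jm(1)[OF that(1)] that(2) deg[of j y] degree_monom_le[of "f j" "e j"]
        by (intro order.trans[OF degree_mult_le] add_mono) auto
      then show ?thesis using Jm(2)[OF that(1)] by (simp add: e_def)
    qed
    have row_deg: "degree (C' $$ (i, y)) \<le> d i" if "y < m" for y
      unfolding row[OF that] using that i deg term_deg JS(3)
      by (intro degree_add_le degree_sum_le) auto
    have row_top: "coeff (C' $$ (i, y)) (d i) = 0" if "y < m" for y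
    proof -
      have "coeff (monom (f j) (e j) * C $$ (j, y)) (d i) = f j * M $$ (j, y)" if "j \<in> J" for j
        using Jm[OF that] \<open>y < m\<close> by (simp add: coeff_monom_mult e_def M_def)
      then have "\<beta> i * coeff (C' $$ (i, y)) (d i) =
          \<beta> i * M $$ (i, y) + (\<Sum>j\<in>J. \<beta> j * M $$ (j, y))"
        using i that by (simp add: row coeff_sum M_def f_def distrib_left sum_distrib_left)
      also have "\<dots> = (\<Sum>j\<in>S. \<beta> j * M $$ (j, y))" using JS by simp
      also have "\<dots> = (\<Sum>j<m. \<beta> j * M $$ (j, y))"
        by (rule sum.mono_neutral_left) (auto simp: S_def)
      finally show ?thesis using \<beta>(3)[OF that] i by simp
    qed
    \<comment> \<open>Otherwise the new row would be constant with vanishing constant term, hence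
      zero, against the nonzero determinant. So the decrement of \<open>d i\<close> is a true
      one.\<close>
    have "d i \<noteq> 0"
    proof
      assume "d i = 0"
      have "C' $$ (i, y) = 0" if "y < m" for y
        using row_deg[OF that] row_top[OF that] \<open>d i = 0\<close> leading_coeff_0_iff[of "C' $$ (i, y)"] by simp
      then have "det C' = 0" using C' i
        by (subst laplace_expansion_row[OF C' i(1)]) simp
      then show False using row_op(1) det \<open>c \<noteq> 0\<close> by simp
    qed
    define d' where "d' = d(i := d i - 1)"
    have less_deg: "(\<Sum>x<m. d' x) < (\<Sum>x<m. d x)"
      using i \<open>d i \<noteq> 0\<close> unfolding d'_def by (intro sum_strict_mono_ex1) auto
    have "C' \<in> lift_products m"
    proof (rule less.hyps[OF less_deg C'])
      fix x y k assume xy: "x < m" "y < m"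
      have "coeff (monom (f j) (e j) * C $$ (j, y)) k \<in> F" if "j \<in> J" for j
        using Jm[OF that] fF[OF that] CF xy by (simp add: coeff_monom_mult)
      then show "coeff (C' $$ (x, y)) k \<in> F"
        using xy CF by (auto simp: C'_def coeff_sum intro!: sum_in add_in)
    next
      fix x y assume xy: "x < m" "y < m"
      show "degree (C' $$ (x, y)) \<le> d' x"
      proof (cases "x = i")
        case True
        \<comment> \<open>A polynomial of degree \<open>d i\<close> with zero coefficient there
          would be zero, whose degree is 0 by convention, but \<open>d i\<close> is
          positive.\<close>
        have "degree (C' $$ (i, y)) \<noteq> d i"
          using row_top[OF xy(2)] \<open>d i \<noteq> 0\<close> by (metis degree_0 leading_coeff_0_iff)
        then show ?thesis using row_deg[OF xy(2)] True by (simp add: d'_def)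
      next
        case False
        then show ?thesis using other xy deg by (simp add: d'_def)
      qed
    next
      show "det C' = [:c:]" using row_op(1) det by simp
    qed
    then show ?thesis by (rule row_op(2))
  qed
qed

text \<open>The inverse \<open>T\<close> of the constant is recorded because it later recovers the
  product of the lifting factors from \<open>A\<close>, and with it the degree bound.\<close>

lemma lift_products_factorization:
  assumes "A \<in> lift_products m"
  shows "\<exists>fs S T. (\<forall>(N, k)\<in>set fs. N \<in> mats_over F m m \<and> N * N = 0\<^sub>m m m \<and> k > 0) \<and>
    S \<in> mats_over F m m \<and> T \<in> mats_over F m m \<and> S * T = 1\<^sub>m m \<and>
    A = foldr (*) (map (\<lambda>(N, k). poly_lift m N k) fs) (1\<^sub>m m) * const_pmat S"
  using assms
proof (induction rule: lift_products.induct)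
  case (const S T)
  then show ?case by (intro exI[of _ "[]"] exI[of _ S] exI[of _ T]) (auto simp: mats_over_iff)
next
  case (lift N k A)
  then obtain fs S T where IH: "\<forall>(N, k)\<in>set fs. N \<in> mats_over F m m \<and> N * N = 0\<^sub>m m m \<and> k > 0"
    "S \<in> mats_over F m m" "T \<in> mats_over F m m" "S * T = 1\<^sub>m m"
    "A = foldr (*) (map (\<lambda>(N, k). poly_lift m N k) fs) (1\<^sub>m m) * const_pmat S" by blast
  define P where "P = foldr (*) (map (\<lambda>(N, k). poly_lift m N k) fs) (1\<^sub>m m)"
  have "P \<in> carrier_mat m m" unfolding P_def using IH(1)
    by (induction fs) (auto intro!: mult_carrier_mat poly_lift_carrier simp: mats_over_iff)
  then have "poly_lift m N k * A = poly_lift m N k * P * const_pmat S"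
    using lift(1) IH(2) unfolding IH(5) P_def[symmetric]
    by (simp add: mats_over_iff poly_lift_carrier assoc_mult_mat[of _ m m _ m _ m])
  then show ?case using IH lift
    by (intro exI[of _ "(N, k) # fs"] exI[of _ S] exI[of _ T]) (auto simp: P_def)
qed

end

section \<open>Primitive factors\<close>

text \<open>The variable is prime: each of its powers is stripped from one of the two factors, until
  their product is a nonzero constant and both have degree 0.\<close>

lemma mult_eq_monomD:
  fixes p q :: "'a :: idom poly"
  assumes "p * q = monom a n" and "a \<noteq> 0"
  shows "\<exists>c b. c \<noteq> 0 \<and> p = monom c b"
  using assms(1)
proof (induction n arbitrary: p q)
  case 0
  then have "p \<noteq> 0" "q \<noteq> 0" using \<open>a \<noteq> 0\<close> by auto
  then have "degree p + degree q = 0"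
    using arg_cong[OF 0, of degree] by (simp add: degree_mult_eq degree_monom_eq \<open>a \<noteq> 0\<close>)
  then obtain c where "p = [:c:]" by (auto elim: degree_eq_zeroE)
  then show ?case using \<open>p \<noteq> 0\<close> by (intro exI[of _ c] exI[of _ 0]) (auto simp: monom_0)
next
  case (Suc n)
  have "coeff p 0 * coeff q 0 = 0"
    using arg_cong[OF Suc.prems, of "\<lambda>r. coeff r 0"] by (simp add: coeff_mult_0)
  then consider "coeff p 0 = 0" | "coeff q 0 = 0" by auto
  then show ?case
  proof cases
    case 1
    then obtain p' where p': "p = pCons 0 p'" by (cases p) auto
    then have "p' * q = monom a n" using Suc.prems by (simp add: monom_Suc)
    then obtain c b where "c \<noteq> 0" "p' = monom c b" using Suc.IH by blast
    then show ?thesis using p' by (intro exI[of _ c] exI[of _ "Suc b"]) (simp add: monom_Suc)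
  next
    case 2
    then obtain q' where q': "q = pCons 0 q'" by (cases q) auto
    then have "p * q' = monom a n" using Suc.prems by (simp add: monom_Suc)
    then show ?thesis using Suc.IH by blast
  qed
qed

text \<open>Multiply the block matrix with rows \<open>(1, - w\<^sup>T)\<close> and \<open>(u, I)\<close> by a unipotent one on either side.\<close>

lemma det_one_plus_outer:
  fixes u w :: "nat \<Rightarrow> 'a :: idom"
  shows "det (1\<^sub>m n + mat n n (\<lambda>(i, j). u i * w j)) = 1 + (\<Sum>i<n. w i * u i)"
proof -
  define I where "I = (1\<^sub>m n :: 'a mat)"
  define E where "E = mat n n (\<lambda>(i, j). u i * w j)"
  define U where "U = mat n 1 (\<lambda>(i, _). u i)"
  define W where "W = mat 1 n (\<lambda>(_, j). w j)"
  have c: "I \<in> carrier_mat n n" "E \<in> carrier_mat n n" "U \<in> carrier_mat n 1" "W \<in> carrier_mat 1 n"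
    by (auto simp: I_def E_def U_def W_def)
  have c1: "(1\<^sub>m 1 :: 'a mat) \<in> carrier_mat 1 1" by simp
  have UW: "U * W = E"
    unfolding U_def W_def E_def by (intro eq_matI) (auto simp: scalar_prod_def)
  have WU: "W * U = (\<Sum>i<n. w i * u i) \<cdot>\<^sub>m 1\<^sub>m 1"
    unfolding U_def W_def by (intro eq_matI) (auto simp: scalar_prod_def atLeast0LessThan)
  let ?X = "four_block_mat (1\<^sub>m 1) (- W) U I"
  let ?Y = "four_block_mat (1\<^sub>m 1) W (0\<^sub>m n 1) I"
  have cX: "?X \<in> carrier_mat (1 + n) (1 + n)" and cY: "?Y \<in> carrier_mat (1 + n) (1 + n)"
    using c by auto
  have "det ?Y = 1"
    using det_four_block_mat_lower_left_zero[OF c1 c(4) refl c(1)] by (simp add: I_def)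
  moreover have "?X * ?Y = four_block_mat (1\<^sub>m 1) (0\<^sub>m 1 n) U (I + E)"
  proof -
    have "?X * ?Y = four_block_mat (1\<^sub>m 1 * 1\<^sub>m 1 + - W * 0\<^sub>m n 1) (1\<^sub>m 1 * W + - W * I)
      (U * 1\<^sub>m 1 + I * 0\<^sub>m n 1) (U * W + I * I)"
      using c by (intro mult_four_block_mat) auto
    also have "1\<^sub>m 1 * 1\<^sub>m 1 + - W * 0\<^sub>m n 1 = (1\<^sub>m 1 :: 'a mat)" using c by simp
    also have "1\<^sub>m 1 * W + - W * I = 0\<^sub>m 1 n" using c by (auto simp: I_def intro!: eq_matI)
    also have "U * 1\<^sub>m 1 + I * 0\<^sub>m n 1 = U" using c by simp
    also have "U * W + I * I = I + E"
      using c unfolding UW by (simp add: I_def comm_add_mat[of _ n n])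
    finally show ?thesis .
  qed
  moreover have "?Y * ?X = four_block_mat ((1 + (\<Sum>i<n. w i * u i)) \<cdot>\<^sub>m 1\<^sub>m 1) (0\<^sub>m 1 n) U I"
  proof -
    have "?Y * ?X = four_block_mat (1\<^sub>m 1 * 1\<^sub>m 1 + W * U) (1\<^sub>m 1 * - W + W * I)
      (0\<^sub>m n 1 * 1\<^sub>m 1 + I * U) (0\<^sub>m n 1 * - W + I * I)"
      using c by (intro mult_four_block_mat) auto
    also have "1\<^sub>m 1 * 1\<^sub>m 1 + W * U = (1 + (\<Sum>i<n. w i * u i)) \<cdot>\<^sub>m 1\<^sub>m 1"
      unfolding WU by (intro eq_matI) auto
    also have "1\<^sub>m 1 * - W + W * I = 0\<^sub>m 1 n" using c by (simp add: I_def)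
    also have "0\<^sub>m n 1 * 1\<^sub>m 1 + I * U = U" using c by (simp add: I_def)
    also have "0\<^sub>m n 1 * - W + I * I = I" using c by (auto simp: I_def intro!: eq_matI)
    finally show ?thesis .
  qed
  moreover have "det (four_block_mat (1\<^sub>m 1) (0\<^sub>m 1 n) U (I + E)) = det (I + E)"
    using det_four_block_mat_upper_right_zero[OF c1 refl c(3), of "I + E"] c by simp
  moreover have "det (four_block_mat ((1 + (\<Sum>i<n. w i * u i)) \<cdot>\<^sub>m 1\<^sub>m 1) (0\<^sub>m 1 n) U I) =
      1 + (\<Sum>i<n. w i * u i)"
    using det_four_block_mat_upper_right_zero[OF _ refl c(3,1), of "(1 + (\<Sum>i<n. w i * u i)) \<cdot>\<^sub>m 1\<^sub>m 1"]
    by (simp add: I_def)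
  \<comment> \<open>As \<open>det ?Y = 1\<close>, both products have the determinant of
    \<open>?X\<close>; one of them shows \<open>I + E\<close> as a diagonal block, the other the
    scalar \<open>1 + w\<^sup>T u\<close>.\<close>
  moreover have "det (?X * ?Y) = det ?X * det ?Y" "det (?Y * ?X) = det ?Y * det ?X"
    using det_mult[OF cX cY] det_mult[OF cY cX] by auto
  ultimately show ?thesis unfolding I_def E_def by simp
qed

lemma outer_self_carrier: "v \<in> carrier_vec m \<Longrightarrow> outer_self v \<in> carrier_mat m m"
  by (auto simp: outer_self_def)

lemma unit_vec_over_sum: "unit_vec_over F m v \<Longrightarrow> (\<Sum>s<m. cnj (v $ s) * v $ s) = 1"
  unfolding unit_vec_over_def vecs_over_def
  by (auto simp: scalar_prod_def atLeast0LessThan mult.commute)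

text \<open>The factor is a rank one update of the identity, so its determinant is
  \<open>1 + (w - 1) v\<^sup>* v\<close>, and \<open>v\<^sup>* v = 1\<close>.\<close>

lemma det_poly_lift_outer_self:
  assumes "unit_vec_over F m v"
  shows "det (poly_lift m (outer_self v) 1) = monom 1 1"
proof -
  have v: "v \<in> carrier_vec m" using assms by (simp add: unit_vec_over_def vecs_over_def)
  let ?x = "monom 1 1 - 1 :: complex poly"
  have "poly_lift m (outer_self v) 1 =
      1\<^sub>m m + mat m m (\<lambda>(i, j). (?x * [:v $ i:]) * [:cnj (v $ j):])"
    unfolding poly_lift_eq[OF outer_self_carrier[OF v]] using v
    by (intro eq_matI) (auto simp: outer_self_def)
  then have "det (poly_lift m (outer_self v) 1) = 1 + (\<Sum>i<m. [:cnj (v $ i):] * (?x * [:v $ i:]))"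
    by (simp only: det_one_plus_outer)
  also have "(\<Sum>i<m. [:cnj (v $ i):] * (?x * [:v $ i:])) = ?x * (\<Sum>i<m. [:cnj (v $ i) * v $ i:])"
    unfolding sum_distrib_left by (intro sum.cong) (auto simp: mult.commute)
  also have "(\<Sum>i<m. [:cnj (v $ i) * v $ i:]) = [:\<Sum>i<m. cnj (v $ i) * v $ i:]"
    by (simp only: const_poly_hom.hom_sum)
  finally show ?thesis unfolding unit_vec_over_sum[OF assms] by simp
qed

context conj_closed_subfield
begin

text \<open>The factor \<open>I - v v\<^sup>* + v v\<^sup>* w\<close> has the inverse
  \<open>I - v v\<^sup>* + v v\<^sup>* w\<^sup>-\<^sup>1\<close>. Applied to \<open>A\<close>, this
  stays polynomial exactly when the row \<open>v\<^sup>* A\<close> is divisible by \<open>w\<close>,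
  and then no degree rises.\<close>

lemma split_primitive_factor:
  assumes norm: "normalizable_over F m" and A: "A \<in> carrier_mat m m"
    and AF: "\<And>i j k. i < m \<Longrightarrow> j < m \<Longrightarrow> coeff (A $$ (i, j)) k \<in> F"
    and deg: "\<And>i j. i < m \<Longrightarrow> j < m \<Longrightarrow> degree (A $$ (i, j)) \<le> D"
    and det: "det A = monom c (Suc b)"
  obtains v B where "unit_vec_over F m v" "A = poly_lift m (outer_self v) 1 * B"
    "B \<in> carrier_mat m m" "\<forall>i<m. \<forall>j<m. \<forall>k. coeff (B $$ (i, j)) k \<in> F"
    "\<forall>i<m. \<forall>j<m. degree (B $$ (i, j)) \<le> D" "det B = monom c b"
proof -
  define A0 where "A0 = map_mat (\<lambda>p. coeff p 0) A"
  have det0: "det A0 = 0" unfolding A0_def coeff_0_hom.hom_det det by simp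
  have A0F: "A0 \<in> mats_over F m m" using A AF by (auto simp: A0_def mats_over_iff)
  obtain \<beta> where \<beta>: "\<And>i. i < m \<Longrightarrow> \<beta> i \<in> F" "\<exists>i<m. \<beta> i \<noteq> 0"
    "\<And>j. j < m \<Longrightarrow> (\<Sum>i<m. \<beta> i * A0 $$ (i, j)) = 0"
    by (rule left_kernel_over[OF A0F det0]) blast
  \<comment> \<open>The left kernel vector is conjugated since it has to act on \<open>A\<close> as
    \<open>v\<^sup>*\<close>. This \<open>w\<close> is a vector, not the variable.\<close>
  define w where "w = vec m (\<lambda>i. cnj (\<beta> i))"
  have "w \<in> vecs_over F m" using \<beta>(1) by (auto simp: w_def vecs_over_def vec_set_def)
  moreover have "w \<noteq> 0\<^sub>v m"
  proof
    assume "w = 0\<^sub>v m"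
    then have "w $ i = 0" if "i < m" for i using that by simp
    then show False using \<beta>(2) by (auto simp: w_def)
  qed
  ultimately obtain a where a: "unit_vec_over F m (a \<cdot>\<^sub>v w)"
    using norm unfolding normalizable_over_def by blast
  define v where "v = a \<cdot>\<^sub>v w"
  have unit: "unit_vec_over F m v" using a by (simp add: v_def)
  then have v: "v \<in> carrier_vec m" and vF: "\<And>i. i < m \<Longrightarrow> v $ i \<in> F"
    by (auto simp: unit_vec_over_def vecs_over_def vec_set_def)
  \<comment> \<open>The row \<open>v\<^sup>* A\<close>; its constant coefficients vanish by the
    choice of \<open>v\<close>, and \<open>q'\<close> below is its quotient by the variable.\<close>
  define q where "q j = (\<Sum>s<m. smult (cnj (v $ s)) (A $$ (s, j)))" for j
  have q0: "coeff (q j) 0 = 0" if "j < m" for j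
  proof -
    have "coeff (q j) 0 = cnj a * (\<Sum>s<m. \<beta> s * A0 $$ (s, j))"
      unfolding q_def coeff_sum sum_distrib_left using that A
      by (intro sum.cong) (auto simp: v_def w_def A0_def)
    then show ?thesis using \<beta>(3)[OF that] by simp
  qed
  have qF: "coeff (q j) k \<in> F" if "j < m" for j k
    using that AF vF by (auto simp: q_def coeff_sum intro!: sum_in)
  have qdeg: "degree (q j) \<le> D" if "j < m" for j
    unfolding q_def using that deg by (intro degree_sum_le) (auto intro: order.trans[OF degree_smult_le])
  have "\<exists>p. q j = pCons 0 p" if "j < m" for j
    using q0[OF that] by (cases "q j") auto
  then obtain q' where q': "\<And>j. j < m \<Longrightarrow> q j = pCons 0 (q' j)" by metis
  have q'F: "coeff (q' j) k \<in> F" if "j < m" for j k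
    using qF[OF that, of "Suc k"] by (simp add: q'[OF that])
  have q'deg: "degree (q' j) \<le> D" if "j < m" for j
    using qdeg[OF that] by (auto simp: q'[OF that] degree_pCons_eq_if split: if_splits)
  define B where "B = mat m m (\<lambda>(i, j). A $$ (i, j) - smult (v $ i) (q j) + smult (v $ i) (q' j))"
  have B: "B \<in> carrier_mat m m" by (simp add: B_def)
  have P: "outer_self v \<in> carrier_mat m m" using v by (rule outer_self_carrier)
  have cP: "const_pmat (outer_self v) \<in> carrier_mat m m" using P by simp
  \<comment> \<open>By \<open>v\<^sup>* v = 1\<close> the row \<open>v\<^sup>* B\<close> equals
    \<open>q + (q' - q) = q'\<close>. Multiplying \<open>B\<close> by the primitive factor thus adds
    \<open>(z\<^sup>-\<^sup>1 - 1) v q'\<close>, which restores \<open>A\<close>.\<close>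
  have PB: "(const_pmat (outer_self v) * B) $$ (i, j) = smult (v $ i) (q' j)" if "i < m" "j < m" for i j
  proof -
    have "(const_pmat (outer_self v) * B) $$ (i, j) =
        (\<Sum>s<m. smult (v $ i) (smult (cnj (v $ s)) (B $$ (s, j))))"
      unfolding index_mult_sum[OF cP B that] using that v
      by (intro sum.cong) (auto simp: outer_self_def)
    also have "\<dots> = smult (v $ i) (\<Sum>s<m. smult (cnj (v $ s)) (B $$ (s, j)))"
      by (simp only: smult_sum2)
    also have "(\<Sum>s<m. smult (cnj (v $ s)) (B $$ (s, j))) =
        (\<Sum>s<m. smult (cnj (v $ s)) (A $$ (s, j)) + smult (cnj (v $ s) * v $ s) (q' j - q j))"
      using that by (intro sum.cong) (auto simp: B_def smult_diff_right smult_add_right)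
    also have "\<dots> = q j + smult (\<Sum>s<m. cnj (v $ s) * v $ s) (q' j - q j)"
      by (simp only: sum.distrib q_def smult_sum)
    finally show ?thesis using unit_vec_over_sum[OF unit] by simp
  qed
  have factor: "poly_lift m (outer_self v) 1 * B = A"
  proof (rule eq_matI)
    fix i j assume "i < dim_row A" "j < dim_col A"
    then have ij: "i < m" "j < m" using A by auto
    have "(poly_lift m (outer_self v) 1 * B) $$ (i, j) =
        B $$ (i, j) + (monom 1 1 - 1) * smult (v $ i) (q' j)"
      unfolding poly_lift_eq[OF P] one_plus_mult[OF cP B] using ij P B PB[OF ij]
      by (simp del: index_mult_mat(1))
    also have "\<dots> = A $$ (i, j)"
      using ij q'[OF ij(2)] by (simp add: B_def monom_Suc monom_0 left_diff_distrib smult_diff_right)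
    finally show "(poly_lift m (outer_self v) 1 * B) $$ (i, j) = A $$ (i, j)" .
  qed (use A B P in \<open>auto simp: poly_lift_def\<close>)
  have "monom 1 1 * det B = monom 1 1 * monom c b"
    using det_mult[OF poly_lift_carrier[OF P] B, of 1]
    unfolding factor det_poly_lift_outer_self[OF unit] det by (simp add: mult_monom)
  then have "det B = monom c b" by simp
  moreover have "coeff (B $$ (i, j)) k \<in> F" if "i < m" "j < m" for i j k
    using that AF vF qF q'F by (simp add: B_def)
  moreover have "degree (B $$ (i, j)) \<le> D" if "i < m" "j < m" for i j
    using that deg qdeg q'deg unfolding B_def
    by (auto intro!: degree_add_le degree_diff_le intro: order.trans[OF degree_smult_le])
  ultimately show thesis using that[OF unit factor[symmetric] B] by blast
qed

lemma split_primitive_factors: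
  assumes norm: "normalizable_over F m" and A: "A \<in> carrier_mat m m"
    and AF: "\<And>i j k. i < m \<Longrightarrow> j < m \<Longrightarrow> coeff (A $$ (i, j)) k \<in> F"
    and deg: "\<And>i j. i < m \<Longrightarrow> j < m \<Longrightarrow> degree (A $$ (i, j)) \<le> D"
    and det: "det A = monom c b"
  shows "\<exists>vs B. length vs = b \<and> (\<forall>v\<in>set vs. unit_vec_over F m v) \<and>
    A = foldr (*) (map (\<lambda>v. poly_lift m (outer_self v) 1) vs) (1\<^sub>m m) * B \<and>
    B \<in> carrier_mat m m \<and> (\<forall>i<m. \<forall>j<m. \<forall>k. coeff (B $$ (i, j)) k \<in> F) \<and>
    (\<forall>i<m. \<forall>j<m. degree (B $$ (i, j)) \<le> D) \<and> det B = [:c:]"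
  using A AF deg det
proof (induction b arbitrary: A)
  case 0
  then show ?case by (intro exI[of _ "[]"] exI[of _ A]) (auto simp: monom_0)
next
  case (Suc b)
  obtain v B where vB: "unit_vec_over F m v" "A = poly_lift m (outer_self v) 1 * B"
    "B \<in> carrier_mat m m" "\<forall>i<m. \<forall>j<m. \<forall>k. coeff (B $$ (i, j)) k \<in> F"
    "\<forall>i<m. \<forall>j<m. degree (B $$ (i, j)) \<le> D" "det B = monom c b"
    by (rule split_primitive_factor[OF norm Suc.prems]) blast
  obtain vs B' where IH: "length vs = b" "\<forall>v\<in>set vs. unit_vec_over F m v"
    "B = foldr (*) (map (\<lambda>v. poly_lift m (outer_self v) 1) vs) (1\<^sub>m m) * B'"
    "B' \<in> carrier_mat m m" "\<forall>i<m. \<forall>j<m. \<forall>k. coeff (B' $$ (i, j)) k \<in> F"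
    "\<forall>i<m. \<forall>j<m. degree (B' $$ (i, j)) \<le> D" "det B' = [:c:]"
    using Suc.IH[of B] vB(3-6) by blast
  have c: "poly_lift m (outer_self v) k \<in> carrier_mat m m" if "unit_vec_over F m v" for v k
    using that by (auto simp: unit_vec_over_def vecs_over_def intro: poly_lift_carrier outer_self_carrier)
  have "foldr (*) (map (\<lambda>v. poly_lift m (outer_self v) 1) vs) (1\<^sub>m m) \<in> carrier_mat m m"
    using IH(2) by (induction vs) (auto intro: mult_carrier_mat c)
  then have "A = foldr (*) (map (\<lambda>v. poly_lift m (outer_self v) 1) (v # vs)) (1\<^sub>m m) * B'"
    using vB(2) c[OF vB(1)] IH(3,4) by (simp add: assoc_mult_mat[of _ m m _ m _ m])
  then show ?case using vB(1) IH by (intro exI[of _ "v # vs"] exI[of _ B']) auto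
qed

end

section \<open>Laurent polynomial matrices\<close>

text \<open>Additive identities need to be checked on monomials only; for a product the rule is
  applied to each factor in turn.\<close>

lemma laurent_induct [case_names single add]:
  fixes p :: laurent
  assumes single: "\<And>n a. P (Poly_Mapping.single n a)" and add: "\<And>p q. P p \<Longrightarrow> P q \<Longrightarrow> P (p + q)"
  shows "P p"
proof -
  have "P (\<Sum>n\<in>A. Poly_Mapping.single n (Poly_Mapping.lookup p n))" if "finite A" for A
    using that
  proof (induction A rule: finite_induct)
    case empty
    then show ?case using single[of 0 0] by simp
  qed (auto intro: single add)
  moreover have "p = (\<Sum>n\<in>Poly_Mapping.keys p. Poly_Mapping.single n (Poly_Mapping.lookup p n))"
    by (rule poly_mapping_eqI)
      (auto simp: lookup_sum lookup_single when_def in_keys_iff sum.delta)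
  ultimately show ?thesis by (metis finite_keys)
qed

section \<open>The adjoint of a Laurent polynomial\<close>

lemma lookup_laurent_star:
  "Poly_Mapping.lookup (laurent_star p) n = cnj (Poly_Mapping.lookup p (- n))"
proof -
  have "Poly_Mapping.lookup (laurent_star p) n =
      (\<Sum>k\<in>Poly_Mapping.keys p. if k = - n then cnj (Poly_Mapping.lookup p k) else 0)"
    unfolding laurent_star_def lookup_sum
    by (intro sum.cong) (auto simp: lookup_single when_def)
  then show ?thesis by (auto simp: in_keys_iff sum.delta)
qed

lemma laurent_star_add: "laurent_star (p + q) = laurent_star p + laurent_star q"
  by (rule poly_mapping_eqI) (simp add: lookup_laurent_star lookup_add)

lemma laurent_star_single: "laurent_star (Poly_Mapping.single n a) = Poly_Mapping.single (- n) (cnj a)"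
  by (rule poly_mapping_eqI) (auto simp: lookup_laurent_star lookup_single when_def)

lemma laurent_star_star: "laurent_star (laurent_star p) = p"
  by (rule poly_mapping_eqI) (simp add: lookup_laurent_star)

lemma laurent_star_mult: "laurent_star (p * q) = laurent_star p * laurent_star q"
proof (induction p rule: laurent_induct)
  case (single n a)
  then show ?case
    by (induction q rule: laurent_induct)
      (simp_all add: mult_single laurent_star_single laurent_star_add distrib_left)
qed (simp_all add: laurent_star_add distrib_right)

lemma laurent_star_0: "laurent_star 0 = 0"
  by (rule poly_mapping_eqI) (simp add: lookup_laurent_star)

lemma laurent_star_1: "laurent_star 1 = 1"
  using laurent_star_single[of 0 1] by simp

lemma laurent_star_sum: "laurent_star (sum f I) = (\<Sum>i\<in>I. laurent_star (f i))"
  by (induction I rule: infinite_finite_induct) (simp_all add: laurent_star_0 laurent_star_add)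

section \<open>Evaluation at \<open>z = 1\<close>\<close>

definition laurent_eval1 :: "laurent \<Rightarrow> complex" where
  "laurent_eval1 p = (\<Sum>n\<in>Poly_Mapping.keys p. Poly_Mapping.lookup p n)"

lemma laurent_eval1_eq:
  "finite A \<Longrightarrow> Poly_Mapping.keys p \<subseteq> A \<Longrightarrow> laurent_eval1 p = (\<Sum>n\<in>A. Poly_Mapping.lookup p n)"
  unfolding laurent_eval1_def by (rule sum.mono_neutral_left) (auto simp: in_keys_iff)

lemma laurent_eval1_single: "laurent_eval1 (Poly_Mapping.single n a) = a"
  by (simp add: laurent_eval1_def)

lemma laurent_eval1_add: "laurent_eval1 (p + q) = laurent_eval1 p + laurent_eval1 q"
proof -
  let ?A = "Poly_Mapping.keys p \<union> Poly_Mapping.keys q"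
  have "laurent_eval1 r = (\<Sum>n\<in>?A. Poly_Mapping.lookup r n)" if "r \<in> {p, q, p + q}" for r
    using that keys_add[of p q] by (intro laurent_eval1_eq) auto
  then show ?thesis by (simp add: lookup_add sum.distrib)
qed

lemma laurent_eval1_mult: "laurent_eval1 (p * q) = laurent_eval1 p * laurent_eval1 q"
proof (induction p rule: laurent_induct)
  case (single n a)
  then show ?case
    by (induction q rule: laurent_induct)
      (simp_all add: mult_single laurent_eval1_single laurent_eval1_add distrib_left)
qed (simp_all add: laurent_eval1_add distrib_right)

interpretation laurent_eval1_hom: comm_ring_hom laurent_eval1
proof
  show "laurent_eval1 1 = 1" using laurent_eval1_single[of 0 1] by simp
qed (simp_all add: laurent_eval1_add laurent_eval1_mult laurent_eval1_def[of 0])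

lemma laurent_eval1_star: "laurent_eval1 (laurent_star p) = cnj (laurent_eval1 p)"
  by (induction p rule: laurent_induct)
    (simp_all add: laurent_star_single laurent_eval1_single laurent_star_add laurent_eval1_add)

section \<open>Polynomials in \<open>z\<^sup>-\<^sup>1\<close> as Laurent polynomials\<close>

interpretation const_laurent_hom: comm_ring_hom "\<lambda>a :: complex. Poly_Mapping.single (0::int) a"
  by unfold_locales (simp_all add: single_add mult_single)

text \<open>The variable goes to \<open>z\<^sup>-\<^sup>1\<close>, so the coefficient of
  \<open>w\<^sup>k\<close> is the one that \<open>lmat_coeff\<close> reads off at
  \<open>k\<close>.\<close>

definition laurent_of_poly :: "complex poly \<Rightarrow> laurent" where
  "laurent_of_poly p = poly (map_poly (Poly_Mapping.single 0) p) (zpow (- 1))"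

lemma laurent_of_poly_pCons:
  "laurent_of_poly (pCons a p) = Poly_Mapping.single 0 a + zpow (- 1) * laurent_of_poly p"
  unfolding laurent_of_poly_def by (simp add: const_laurent_hom.map_poly_pCons_hom)

lemma laurent_of_poly_0: "laurent_of_poly 0 = 0"
  by (simp add: laurent_of_poly_def)

lemma laurent_of_poly_const: "laurent_of_poly [:a:] = Poly_Mapping.single 0 a"
  by (simp add: laurent_of_poly_pCons laurent_of_poly_0)

lemma laurent_of_poly_add: "laurent_of_poly (p + q) = laurent_of_poly p + laurent_of_poly q"
  by (induction p q rule: poly_induct2)
    (simp_all add: laurent_of_poly_pCons laurent_of_poly_0 single_add algebra_simps)

lemma laurent_of_poly_smult: "laurent_of_poly (smult a p) = Poly_Mapping.single 0 a * laurent_of_poly p"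
  by (induction p) (simp_all add: laurent_of_poly_pCons laurent_of_poly_0 distrib_left mult_single mult.left_commute)

lemma laurent_of_poly_mult: "laurent_of_poly (p * q) = laurent_of_poly p * laurent_of_poly q"
  by (induction p)
    (simp_all add: laurent_of_poly_pCons laurent_of_poly_0 laurent_of_poly_add laurent_of_poly_smult algebra_simps)

interpretation laurent_of_poly_hom: comm_ring_hom laurent_of_poly
proof
  show "laurent_of_poly 1 = 1" using laurent_of_poly_const[of 1] by simp
qed (simp_all add: laurent_of_poly_add laurent_of_poly_mult laurent_of_poly_0)

lemma laurent_of_poly_monom: "laurent_of_poly (monom a k) = Poly_Mapping.single (- int k) a"
  by (induction k)
    (simp_all add: monom_0 laurent_of_poly_const monom_Suc laurent_of_poly_pCons zpow_def mult_single)

lemma lookup_laurent_of_poly: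
  "Poly_Mapping.lookup (laurent_of_poly p) (- n) = (if n < 0 then 0 else coeff p (nat n))"
proof -
  have "laurent_of_poly p = laurent_of_poly (\<Sum>i\<le>degree p. monom (coeff p i) i)"
    by (simp add: poly_as_sum_of_monoms)
  also have "\<dots> = (\<Sum>i\<le>degree p. Poly_Mapping.single (- int i) (coeff p i))"
    by (simp add: laurent_of_poly_hom.hom_sum laurent_of_poly_monom)
  finally have *: "Poly_Mapping.lookup (laurent_of_poly p) (- n) =
      (\<Sum>i\<le>degree p. if int i = n then coeff p i else 0)"
    by (auto simp: lookup_sum lookup_single when_def intro!: sum.cong)
  show ?thesis
  proof (cases "n < 0")
    case True
    then show ?thesis unfolding * by (auto intro!: sum.neutral)
  next
    case False
    then obtain k where "n = int k" by (metis nonneg_int_cases not_less)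
    then show ?thesis unfolding * by (simp add: sum.delta coeff_eq_0)
  qed
qed

lemma laurent_of_poly_inject: "laurent_of_poly p = laurent_of_poly q \<longleftrightarrow> p = q"
proof
  assume "laurent_of_poly p = laurent_of_poly q"
  then have "coeff p n = coeff q n" for n
    using lookup_laurent_of_poly[of p "int n"] lookup_laurent_of_poly[of q "int n"] by simp
  then show "p = q" by (simp add: poly_eqI)
qed simp

section \<open>Adjoint matrices and the pair relation of single factors\<close>

lemma const_lmat_carrier: "A \<in> carrier_mat n k \<Longrightarrow> const_lmat A \<in> carrier_mat n k"
  by (simp add: const_lmat_def)

lemma const_lmat_mult:
  "A \<in> carrier_mat n k \<Longrightarrow> B \<in> carrier_mat k l \<Longrightarrow> const_lmat (A * B) = const_lmat A * const_lmat B"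
  unfolding const_lmat_def by (rule const_laurent_hom.mat_hom_mult)

lemma lmat_of_poly_const: "map_mat laurent_of_poly (const_pmat A) = const_lmat A"
  by (intro eq_matI) (auto simp: const_lmat_def laurent_of_poly_const)

lemma lift_L_eq: "N \<in> carrier_mat m m \<Longrightarrow> lift_L m N k = 1\<^sub>m m + (zpow (- int k) - 1) \<cdot>\<^sub>m const_lmat N"
  unfolding lift_L_def const_lmat_def by (intro eq_matI) (auto simp: algebra_simps)

lemma lift_R_eq:
  "N \<in> carrier_mat m m \<Longrightarrow> lift_R m N k = 1\<^sub>m m + (1 - zpow (int k)) \<cdot>\<^sub>m const_lmat (mat_adjoint N)"
  using mat_adjoint_carrier[of N m m] unfolding lift_R_def const_lmat_def
  by (intro eq_matI) (auto simp: algebra_simps)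

lemma lift_L_carrier: "N \<in> carrier_mat m m \<Longrightarrow> lift_L m N k \<in> carrier_mat m m"
  by (simp add: lift_L_def const_lmat_def)

lemma lift_R_carrier: "N \<in> carrier_mat m m \<Longrightarrow> lift_R m N k \<in> carrier_mat m m"
  using mat_adjoint_carrier[of N m m] by (auto simp: lift_R_eq const_lmat_def)

lemma lmat_of_poly_lift:
  "N \<in> carrier_mat m m \<Longrightarrow> map_mat laurent_of_poly (poly_lift m N k) = lift_L m N k"
  unfolding poly_lift_def lift_L_def const_lmat_def
  by (intro eq_matI) (auto simp: laurent_of_poly_const laurent_of_poly_monom zpow_def
      laurent_of_poly_hom.hom_minus laurent_of_poly_add laurent_of_poly_mult laurent_of_poly_smult)

lemma lmat_adjoint_carrier: "A \<in> carrier_mat n k \<Longrightarrow> lmat_adjoint A \<in> carrier_mat k n"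
  by (simp add: lmat_adjoint_def)

lemma lmat_adjoint_index:
  "A \<in> carrier_mat n k \<Longrightarrow> i < k \<Longrightarrow> j < n \<Longrightarrow> lmat_adjoint A $$ (i, j) = laurent_star (A $$ (j, i))"
  by (simp add: lmat_adjoint_def)

lemma lmat_adjoint_mult:
  assumes A: "A \<in> carrier_mat n k" and B: "B \<in> carrier_mat k l"
  shows "lmat_adjoint (A * B) = lmat_adjoint B * lmat_adjoint A"
proof (rule eq_matI)
  fix i j assume "i < dim_row (lmat_adjoint B * lmat_adjoint A)" "j < dim_col (lmat_adjoint B * lmat_adjoint A)"
  then have ij: "i < l" "j < n" using A B by (auto simp: lmat_adjoint_def)
  have AB: "A * B \<in> carrier_mat n l" using A B by simp
  have "lmat_adjoint (A * B) $$ (i, j) = (\<Sum>s<k. laurent_star (A $$ (j, s)) * laurent_star (B $$ (s, i)))"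
    unfolding lmat_adjoint_index[OF AB ij] index_mult_sum[OF A B ij(2,1)] laurent_star_sum laurent_star_mult ..
  also have "\<dots> = (lmat_adjoint B * lmat_adjoint A) $$ (i, j)"
    unfolding index_mult_sum[OF lmat_adjoint_carrier[OF B] lmat_adjoint_carrier[OF A] ij]
    using ij by (intro sum.cong) (auto simp: lmat_adjoint_index[OF A] lmat_adjoint_index[OF B] mult.commute)
  finally show "lmat_adjoint (A * B) $$ (i, j) = (lmat_adjoint B * lmat_adjoint A) $$ (i, j)" .
qed (use A B in \<open>auto simp: lmat_adjoint_def\<close>)

lemma lmat_adjoint_adjoint: "lmat_adjoint (lmat_adjoint A) = A"
  by (intro eq_matI) (auto simp: lmat_adjoint_def laurent_star_star)

lemma lmat_adjoint_one_plus:
  assumes "N \<in> carrier_mat m m"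
  shows "lmat_adjoint (1\<^sub>m m + s \<cdot>\<^sub>m const_lmat N) = 1\<^sub>m m + laurent_star s \<cdot>\<^sub>m const_lmat (mat_adjoint N)"
  using assms mat_adjoint_carrier[OF assms]
  by (intro eq_matI)
    (auto simp: lmat_adjoint_def const_lmat_def mat_adjoint_index[of N m m] laurent_star_add
      laurent_star_mult laurent_star_single laurent_star_0 laurent_star_1)

lemma lmat_adjoint_const: "lmat_adjoint (const_lmat A) = const_lmat (mat_adjoint A)"
proof -
  have A: "A \<in> carrier_mat (dim_row A) (dim_col A)" by simp
  then show ?thesis
    using mat_adjoint_carrier[OF A]
    by (intro eq_matI) (auto simp: lmat_adjoint_def const_lmat_def laurent_star_single mat_adjoint_index[OF A])
qed

lemma laurent_star_zpow: "laurent_star (zpow k) = zpow (- k)"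
  by (simp add: zpow_def laurent_star_single)

lemma zpow_mult: "zpow k * zpow l = zpow (k + l)"
  by (simp add: zpow_def mult_single)

lemma zpow_0: "zpow 0 = 1"
  by (simp add: zpow_def)

lemma mat_adjoint_adjoint: "mat_adjoint (mat_adjoint A) = (A :: complex mat)"
proof -
  have A: "A \<in> carrier_mat (dim_row A) (dim_col A)" by simp
  note A' = mat_adjoint_carrier[OF A]
  show ?thesis
    using A mat_adjoint_carrier[OF A'] by (intro eq_matI)
      (auto simp: mat_adjoint_index[OF A'] mat_adjoint_index[OF A])
qed

text \<open>The adjoint of the second factor is \<open>I - (z\<^sup>-\<^sup>k - 1) N\<close>, and
  \<open>I + s N\<close> and \<open>I - s N\<close> are inverse to each other when \<open>N\<close>
  squares to zero.\<close>

lemma lift_L_mult_adjoint_lift_R: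
  assumes N: "N \<in> carrier_mat m m" and NN: "N * N = 0\<^sub>m m m"
  shows "lift_L m N k * lmat_adjoint (lift_R m N k) = 1\<^sub>m m"
proof -
  have cN: "const_lmat N \<in> carrier_mat m m" using N by (rule const_lmat_carrier)
  have "const_lmat N * const_lmat N = 0 \<cdot>\<^sub>m const_lmat N"
    unfolding const_lmat_mult[OF N N, symmetric] NN using N by (intro eq_matI) (auto simp: const_lmat_def)
  note mult = one_plus_mult_one_plus[OF cN this]
  have star: "laurent_star (1 - zpow (int k)) = 1 - zpow (- int k)"
    using laurent_star_add[of "1 - zpow (int k)" "zpow (int k)"]
    by (simp add: laurent_star_1 laurent_star_zpow eq_diff_eq)
  have "lift_L m N k * lmat_adjoint (lift_R m N k) =
      1\<^sub>m m + (zpow (- int k) - 1 + (1 - zpow (- int k)) + (zpow (- int k) - 1) * (1 - zpow (- int k)) * 0) \<cdot>\<^sub>m const_lmat N"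
    unfolding lift_L_eq[OF N] lift_R_eq[OF N] lmat_adjoint_one_plus[OF mat_adjoint_carrier[OF N]]
      mat_adjoint_adjoint star by (rule mult)
  then show ?thesis using cN by (auto intro!: eq_matI)
qed

lemma outer_self_idempotent:
  assumes "unit_vec_over F m v"
  shows "outer_self v * outer_self v = outer_self v"
proof -
  have v: "v \<in> carrier_vec m" and unit: "(\<Sum>s<m. v $ s * cnj (v $ s)) = 1"
    using assms by (auto simp: unit_vec_over_def vecs_over_def scalar_prod_def atLeast0LessThan)
  have c: "outer_self v \<in> carrier_mat m m" using v by (auto simp: outer_self_def)
  show ?thesis
  proof (rule eq_matI)
    fix i j assume "i < dim_row (outer_self v)" "j < dim_col (outer_self v)"
    then have ij: "i < m" "j < m" using c by auto
    have "(outer_self v * outer_self v) $$ (i, j) = v $ i * cnj (v $ j) * (\<Sum>s<m. v $ s * cnj (v $ s))"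
      unfolding index_mult_sum[OF c c ij] sum_distrib_left using v ij
      by (intro sum.cong) (auto simp: outer_self_def)
    then show "(outer_self v * outer_self v) $$ (i, j) = outer_self v $$ (i, j)"
      using v ij unfolding unit by (simp add: outer_self_def)
  qed (use c in auto)
qed

lemma primitive_paraunitary_lift:
  "primitive_paraunitary F m V \<longleftrightarrow> (\<exists>v. unit_vec_over F m v \<and> V = lift_L m (outer_self v) 1)"
  by (simp add: primitive_paraunitary_def lift_L_def)

lemma primitive_paraunitary_carrier: "primitive_paraunitary F m V \<Longrightarrow> V \<in> carrier_mat m m"
  unfolding primitive_paraunitary_lift
  by (auto simp: unit_vec_over_def vecs_over_def outer_self_def intro!: lift_L_carrier)

text \<open>The projection is self-adjoint and idempotent, so it occurs in the product with
  coefficient \<open>s + t + s t = (1 + s) (1 + t) - 1\<close>, where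
  \<open>1 + s = z\<^sup>-\<^sup>1\<close> and \<open>1 + t = z\<close>.\<close>

lemma primitive_paraunitary_mult_adjoint:
  assumes "primitive_paraunitary F m V"
  shows "V * lmat_adjoint V = 1\<^sub>m m"
proof -
  obtain v where v: "unit_vec_over F m v" and V: "V = lift_L m (outer_self v) 1"
    using assms unfolding primitive_paraunitary_lift by blast
  have c: "outer_self v \<in> carrier_mat m m"
    using v by (auto simp: unit_vec_over_def vecs_over_def outer_self_def)
  have cP: "const_lmat (outer_self v) \<in> carrier_mat m m" using c by (rule const_lmat_carrier)
  have "mat_adjoint (outer_self v) = outer_self v"
  proof (rule eq_matI)
    fix i j assume "i < dim_row (outer_self v)" "j < dim_col (outer_self v)"
    then show "mat_adjoint (outer_self v) $$ (i, j) = outer_self v $$ (i, j)"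
      using c by (subst mat_adjoint_index[OF c]) (auto simp: outer_self_def)
  qed (use c mat_adjoint_carrier[OF c] in auto)
  moreover have "const_lmat (outer_self v) * const_lmat (outer_self v) = 1 \<cdot>\<^sub>m const_lmat (outer_self v)"
    unfolding const_lmat_mult[OF c c, symmetric] outer_self_idempotent[OF v] by (intro eq_matI) auto
  moreover have "laurent_star (zpow (- int 1) - 1) = zpow (int 1) - 1"
    using laurent_star_add[of "zpow (- int 1) - 1" 1]
    by (simp add: laurent_star_1 laurent_star_zpow eq_diff_eq)
  ultimately have "V * lmat_adjoint V = 1\<^sub>m m + (zpow (- int 1) - 1 + (zpow (int 1) - 1) +
      (zpow (- int 1) - 1) * (zpow (int 1) - 1) * 1) \<cdot>\<^sub>m const_lmat (outer_self v)"
    unfolding V lift_L_eq[OF c] lmat_adjoint_one_plus[OF c] by (simp only: one_plus_mult_one_plus[OF cP])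
  also have "zpow (- int 1) - 1 + (zpow (int 1) - 1) + (zpow (- int 1) - 1) * (zpow (int 1) - 1) * 1 = 0"
    by (simp add: algebra_simps zpow_mult zpow_0)
  finally show ?thesis using cP by (auto intro!: eq_matI)
qed

section \<open>The canonical Haar matrix\<close>

lemma mult_scalar_commute:
  fixes A B :: "'a :: field mat"
  assumes A: "A \<in> carrier_mat n n" and B: "B \<in> carrier_mat n n"
    and AB: "A * B = c \<cdot>\<^sub>m 1\<^sub>m n" and "c \<noteq> 0"
  shows "B * A = c \<cdot>\<^sub>m 1\<^sub>m n"
proof -
  have "A * (inverse c \<cdot>\<^sub>m B) = 1\<^sub>m n"
    unfolding mult_smult_distrib[OF A B] AB using \<open>c \<noteq> 0\<close> by (intro eq_matI) auto
  then have *: "inverse c \<cdot>\<^sub>m B * A = 1\<^sub>m n"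
    using A B by (intro mat_mult_left_right_inverse[OF A]) auto
  have "B * A = c \<cdot>\<^sub>m (inverse c \<cdot>\<^sub>m (B * A))"
    using A B \<open>c \<noteq> 0\<close> by (intro eq_matI) (auto simp del: index_mult_mat(1) simp flip: mult.assoc)
  also have "inverse c \<cdot>\<^sub>m (B * A) = 1\<^sub>m n"
    using * by (simp only: mult_smult_assoc_mat[OF B A])
  finally show ?thesis .
qed

lemma mat_adjoint_mult:
  fixes A B :: "complex mat"
  assumes A: "A \<in> carrier_mat n k" and B: "B \<in> carrier_mat k l"
  shows "mat_adjoint (A * B) = mat_adjoint B * mat_adjoint A"
proof (rule eq_matI)
  note A' = mat_adjoint_carrier[OF A] and B' = mat_adjoint_carrier[OF B]
  fix i j assume "i < dim_row (mat_adjoint B * mat_adjoint A)" "j < dim_col (mat_adjoint B * mat_adjoint A)"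
  then have ij: "i < l" "j < n" using A' B' by auto
  have AB: "A * B \<in> carrier_mat n l" using A B by simp
  have "mat_adjoint (A * B) $$ (i, j) = (\<Sum>s<k. cnj (A $$ (j, s)) * cnj (B $$ (s, i)))"
    unfolding mat_adjoint_index[OF AB ij] index_mult_sum[OF A B ij(2,1)] by simp
  also have "\<dots> = (mat_adjoint B * mat_adjoint A) $$ (i, j)"
    unfolding index_mult_sum[OF B' A' ij]
    using ij by (intro sum.cong) (auto simp: mat_adjoint_index[OF A] mat_adjoint_index[OF B] mult.commute)
  finally show "mat_adjoint (A * B) $$ (i, j) = (mat_adjoint B * mat_adjoint A) $$ (i, j)" .
qed (use mat_adjoint_carrier[of "A * B" n l] mat_adjoint_carrier[OF A] mat_adjoint_carrier[OF B] A B in auto)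

lemma haar_carrier: "haar m \<in> carrier_mat m m"
  by (simp add: haar_def)

lemma haar_row_0: "s < m \<Longrightarrow> haar m $$ (0, s) = 1"
  by (simp add: haar_def)

text \<open>Hides the square root. Orthogonality uses only that \<open>a\<close> is real, the norm
  only the equation for its square.\<close>

lemma haar_row:
  assumes "0 < i" "i < m"
  obtains a :: real where "a\<^sup>2 * (real (m - i) * real (m - i) + real (m - i)) = real m"
    "\<And>s. s < m \<Longrightarrow> haar m $$ (i, s) =
      (if s < i - 1 then 0 else if s = i - 1 then - of_nat (m - i) * of_real a else of_real a)"
proof
  let ?s = "real (m - i)"
  let ?a = "sqrt (real m / (?s\<^sup>2 + ?s))"
  have "?s > 0" using assms by simp
  then have "?s\<^sup>2 + ?s > 0" by (simp add: add_pos_pos)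
  then show "?a\<^sup>2 * (?s * ?s + ?s) = real m" by (simp add: power2_eq_square del: of_nat_diff)
  show "haar m $$ (i, s) = (if s < i - 1 then 0 else if s = i - 1 then - of_nat (m - i) * of_real ?a else of_real ?a)"
    if "s < m" for s
    using that assms by (auto simp: haar_def Let_def)
qed

text \<open>Arbitrary \<open>x\<close> and \<open>y\<close> let this serve row sums, inner products
  and norms alike, since all of them have summands of this shape.\<close>

lemma sum_haar_row:
  fixes x y :: complex
  assumes "0 < i" "i < m"
  shows "(\<Sum>s<m. if s < i - 1 then 0 else if s = i - 1 then x else y) = x + of_nat (m - i) * y"
proof -
  let ?f = "\<lambda>s. if s < i - 1 then 0 else if s = i - 1 then x else y"
  have "(\<Sum>s<m. ?f s) = (\<Sum>s = i - 1..<m. ?f s)"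
    by (rule sum.mono_neutral_right) auto
  also have "\<dots> = ?f (i - 1) + (\<Sum>s = i..<m. ?f s)"
    using assms sum.atLeast_Suc_lessThan[of "i - 1" m ?f] by simp
  also have "(\<Sum>s = i..<m. ?f s) = (\<Sum>s = i..<m. y)"
    using assms by (intro sum.cong) auto
  finally show ?thesis by simp
qed

lemma haar_row_sum:
  assumes "i < m"
  shows "(\<Sum>s<m. haar m $$ (i, s)) = (if i = 0 then of_nat m else 0)"
proof (cases "i = 0")
  case True
  then show ?thesis by (simp add: haar_row_0)
next
  case False
  then obtain a :: real where a: "\<And>s. s < m \<Longrightarrow> haar m $$ (i, s) =
      (if s < i - 1 then 0 else if s = i - 1 then - of_nat (m - i) * of_real a else of_real a)"
    using haar_row[of i m] assms by blast
  have "(\<Sum>s<m. haar m $$ (i, s)) =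
      (\<Sum>s<m. if s < i - 1 then 0 else if s = i - 1 then - of_nat (m - i) * of_real a else of_real a)"
    using a by (intro sum.cong) auto
  then show ?thesis using sum_haar_row[of i m] False assms by (simp del: of_nat_diff)
qed

text \<open>An earlier row is constant on the support of a later one, whose entries sum to zero.\<close>

lemma haar_rows_orthogonal:
  assumes "i < j" "j < m"
  shows "(\<Sum>s<m. haar m $$ (i, s) * cnj (haar m $$ (j, s))) = 0"
proof -
  obtain b :: real where b: "\<And>s. s < m \<Longrightarrow> haar m $$ (j, s) =
      (if s < j - 1 then 0 else if s = j - 1 then - of_nat (m - j) * of_real b else of_real b)"
    using haar_row[of j m] assms by auto
  obtain a :: real where a: "\<And>s. s < m \<Longrightarrow> j - 1 \<le> s \<Longrightarrow> haar m $$ (i, s) = of_real a"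
  proof (cases "i = 0")
    case True
    then show thesis using that[of 1] by (simp add: haar_row_0)
  next
    case False
    then obtain a :: real where a: "\<And>s. s < m \<Longrightarrow> haar m $$ (i, s) =
        (if s < i - 1 then 0 else if s = i - 1 then - of_nat (m - i) * of_real a else of_real a)"
      using haar_row[of i m] assms by auto
    show thesis by (rule that[of a]) (use a assms False in auto)
  qed
  have "(\<Sum>s<m. haar m $$ (i, s) * cnj (haar m $$ (j, s))) =
      (\<Sum>s<m. if s < j - 1 then 0 else if s = j - 1 then of_real a * (- of_nat (m - j) * of_real b)
        else of_real a * of_real b)"
    using a b by (intro sum.cong) auto
  then show ?thesis using sum_haar_row[of j m] assms by (simp del: of_nat_diff)
qed

lemma haar_row_norm:
  assumes "i < m"
  shows "(\<Sum>s<m. haar m $$ (i, s) * cnj (haar m $$ (i, s))) = of_nat m"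
proof (cases "i = 0")
  case True
  then show ?thesis by (simp add: haar_row_0)
next
  case False
  then obtain a :: real where sq: "a\<^sup>2 * (real (m - i) * real (m - i) + real (m - i)) = real m"
    and a: "\<And>s. s < m \<Longrightarrow> haar m $$ (i, s) =
      (if s < i - 1 then 0 else if s = i - 1 then - of_nat (m - i) * of_real a else of_real a)"
    using haar_row[of i m] assms by auto
  have "(\<Sum>s<m. haar m $$ (i, s) * cnj (haar m $$ (i, s))) =
      (\<Sum>s<m. if s < i - 1 then 0 else if s = i - 1 then of_nat (m - i) * of_nat (m - i) * of_real (a\<^sup>2)
        else of_real (a\<^sup>2))"
    using a by (intro sum.cong) (auto simp: power2_eq_square simp del: of_nat_diff)
  also have "\<dots> = of_real (a\<^sup>2 * (real (m - i) * real (m - i) + real (m - i)))"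
    using sum_haar_row[of i m] False assms by (simp add: algebra_simps del: of_nat_diff)
  also have "\<dots> = of_nat m" unfolding sq by simp
  finally show ?thesis .
qed

lemma haar_mult_adjoint: "haar m * mat_adjoint (haar m) = of_nat m \<cdot>\<^sub>m 1\<^sub>m m"
proof (rule eq_matI)
  note H = haar_carrier[of m] and H' = mat_adjoint_carrier[OF haar_carrier[of m]]
  fix i j assume "i < dim_row (of_nat m \<cdot>\<^sub>m 1\<^sub>m m :: complex mat)" "j < dim_col (of_nat m \<cdot>\<^sub>m 1\<^sub>m m :: complex mat)"
  then have ij: "i < m" "j < m" by auto
  have *: "(haar m * mat_adjoint (haar m)) $$ (i, j) = (\<Sum>s<m. haar m $$ (i, s) * cnj (haar m $$ (j, s)))"
    unfolding index_mult_sum[OF H H' ij] using ij by (intro sum.cong) (auto simp: mat_adjoint_index[OF H])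
  \<comment> \<open>Orthogonality is available with the earlier row first; conjugation gives the
    other order.\<close>
  have "(\<Sum>s<m. haar m $$ (i, s) * cnj (haar m $$ (j, s))) =
      cnj (\<Sum>s<m. haar m $$ (j, s) * cnj (haar m $$ (i, s)))"
    by (simp add: mult.commute)
  then show "(haar m * mat_adjoint (haar m)) $$ (i, j) = (of_nat m \<cdot>\<^sub>m 1\<^sub>m m) $$ (i, j)"
    using haar_rows_orthogonal[of i j m] haar_rows_orthogonal[of j i m] haar_row_norm[of i m] ij
    unfolding * by (cases i j rule: linorder_cases) auto
qed (use haar_carrier[of m] mat_adjoint_carrier[OF haar_carrier[of m]] in auto)

lemma adjoint_mult_haar: "mat_adjoint (haar m) * haar m = of_nat m \<cdot>\<^sub>m 1\<^sub>m m"
proof (cases "m = 0")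
  case True
  then show ?thesis using haar_carrier[of m] mat_adjoint_carrier[OF haar_carrier[of m]]
    by (intro eq_matI) auto
next
  case False
  then show ?thesis
    using mult_scalar_commute[OF haar_carrier mat_adjoint_carrier[OF haar_carrier] haar_mult_adjoint, of m]
    by simp
qed

section \<open>Block diagonal matrices with corner entry one\<close>

lemma diag_one_carrier: "m > 0 \<Longrightarrow> G \<in> carrier_mat (m - 1) (m - 1) \<Longrightarrow> diag_one m G \<in> carrier_mat m m"
  unfolding diag_one_def using four_block_carrier_mat[of "1\<^sub>m 1" 1 1 G "m - 1" "m - 1"] by simp

lemma diag_one_index:
  assumes "G \<in> carrier_mat (m - 1) (m - 1)" "i < m" "j < m"
  shows "diag_one m G $$ (i, j) = (if i = 0 \<or> j = 0 then if i = j then 1 else 0 else G $$ (i - 1, j - 1))"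
  using assms unfolding diag_one_def by auto

lemma diag_one_mult:
  assumes "m > 0" "A \<in> carrier_mat (m - 1) (m - 1)" "B \<in> carrier_mat (m - 1) (m - 1)"
  shows "diag_one m A * diag_one m B = diag_one m (A * B)"
proof -
  have "diag_one m A * diag_one m B = four_block_mat (1\<^sub>m 1 * 1\<^sub>m 1 + 0\<^sub>m 1 (m - 1) * 0\<^sub>m (m - 1) 1)
      (1\<^sub>m 1 * 0\<^sub>m 1 (m - 1) + 0\<^sub>m 1 (m - 1) * B) (0\<^sub>m (m - 1) 1 * 1\<^sub>m 1 + A * 0\<^sub>m (m - 1) 1)
      (0\<^sub>m (m - 1) 1 * 0\<^sub>m 1 (m - 1) + A * B)"
    unfolding diag_one_def using assms by (intro mult_four_block_mat) auto
  then show ?thesis using assms unfolding diag_one_def by simp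
qed

lemma diag_one_inject:
  assumes "A \<in> carrier_mat (m - 1) (m - 1)" "B \<in> carrier_mat (m - 1) (m - 1)"
    and "diag_one m A = diag_one m B"
  shows "A = B"
proof (rule eq_matI)
  fix i j assume "i < dim_row B" "j < dim_col B"
  then have ij: "Suc i < m" "Suc j < m" using assms by auto
  have "A $$ (i, j) = diag_one m A $$ (Suc i, Suc j)" "B $$ (i, j) = diag_one m B $$ (Suc i, Suc j)"
    using ij by (simp_all add: diag_one_index[OF assms(1)] diag_one_index[OF assms(2)])
  then show "A $$ (i, j) = B $$ (i, j)" using assms(3) by simp
qed (use assms in auto)

lemma diag_one_one: "m > 0 \<Longrightarrow> diag_one m (1\<^sub>m (m - 1)) = 1\<^sub>m m"
  unfolding diag_one_def by (simp add: four_block_one_mat)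

lemma mat_adjoint_diag_one:
  assumes "m > 0" "G \<in> carrier_mat (m - 1) (m - 1)"
  shows "mat_adjoint (diag_one m G) = diag_one m (mat_adjoint G)"
proof (rule eq_matI)
  note D = diag_one_carrier[OF assms] and G' = mat_adjoint_carrier[OF assms(2)]
  note D' = diag_one_carrier[OF assms(1) G']
  fix i j assume "i < dim_row (diag_one m (mat_adjoint G))" "j < dim_col (diag_one m (mat_adjoint G))"
  then have ij: "i < m" "j < m" using D' by auto
  show "mat_adjoint (diag_one m G) $$ (i, j) = diag_one m (mat_adjoint G) $$ (i, j)"
    unfolding mat_adjoint_index[OF D ij] diag_one_index[OF G' ij] diag_one_index[OF assms(2) ij(2,1)]
    using ij by (auto simp: mat_adjoint_index[OF assms(2)])
qed (use diag_one_carrier[OF assms] mat_adjoint_carrier[OF diag_one_carrier[OF assms]]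
    diag_one_carrier[OF assms(1) mat_adjoint_carrier[OF assms(2)]] in auto)

lemma diag_one_eqI:
  assumes D: "D \<in> carrier_mat m m"
    and "\<And>i. i < m \<Longrightarrow> D $$ (i, 0) = (if i = 0 then 1 else 0)"
    and "\<And>j. j < m \<Longrightarrow> D $$ (0, j) = (if j = 0 then 1 else 0)" and "m > 0"
  shows "D = diag_one m (mat (m - 1) (m - 1) (\<lambda>(i, j). D $$ (Suc i, Suc j)))"
proof (rule eq_matI)
  let ?G = "mat (m - 1) (m - 1) (\<lambda>(i, j). D $$ (Suc i, Suc j))"
  have G: "?G \<in> carrier_mat (m - 1) (m - 1)" by simp
  fix i j assume "i < dim_row (diag_one m ?G)" "j < dim_col (diag_one m ?G)"
  then have ij: "i < m" "j < m" using diag_one_carrier[OF \<open>m > 0\<close> G] by auto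
  show "D $$ (i, j) = diag_one m ?G $$ (i, j)"
    unfolding diag_one_index[OF G ij] using ij assms(2)[OF ij(1)] assms(3)[OF ij(2)]
    by (cases i; cases j) auto
qed (use D diag_one_carrier[OF \<open>m > 0\<close>, of "mat (m - 1) (m - 1) (\<lambda>(i, j). D $$ (Suc i, Suc j))"] in auto)

context conj_closed_subfield
begin

text \<open>Let \<open>D = A H\<^sup>* / m\<close> and \<open>E = H B\<^sup>* / m\<close>, which are
  inverse to each other. The row sums of \<open>A\<close> fix column 0 of \<open>D\<close>, which
  alone would only make \<open>D\<close> block triangular. The row sums of \<open>B\<close> fix row
  0 of \<open>E\<close>, and inversion carries this over to \<open>D\<close>.\<close>

lemma haar_factorization:
  assumes "m > 0" and haar: "haar_over F m"
    and A: "A \<in> mats_over F m m" and B: "B \<in> mats_over F m m"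
    and AB: "A * mat_adjoint B = of_nat m \<cdot>\<^sub>m 1\<^sub>m m"
    and sumA: "\<And>i. i < m \<Longrightarrow> (\<Sum>j<m. A $$ (i, j)) = (if i = 0 then of_nat m else 0)"
    and sumB: "\<And>i. i < m \<Longrightarrow> (\<Sum>j<m. B $$ (i, j)) = (if i = 0 then of_nat m else 0)"
  obtains G K where "G \<in> mats_over F (m - 1) (m - 1)" "K \<in> mats_over F (m - 1) (m - 1)"
    "G * K = 1\<^sub>m (m - 1)" "K * G = 1\<^sub>m (m - 1)" "A = diag_one m G * haar m"
proof -
  define H where "H = haar m"
  define H' where "H' = mat_adjoint H"
  have HF: "H \<in> mats_over F m m" using haar by (simp add: H_def haar_over_def)
  have H'F: "H' \<in> mats_over F m m" unfolding H'_def by (rule mat_adjoint_mats_over[OF HF])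
  have H: "H \<in> carrier_mat m m" and H': "H' \<in> carrier_mat m m"
    using HF H'F by (auto simp: mats_over_iff)
  have cA: "A \<in> carrier_mat m m" and cB: "B \<in> carrier_mat m m" using A B by (auto simp: mats_over_iff)
  have cB': "mat_adjoint B \<in> carrier_mat m m" using cB by (rule mat_adjoint_carrier)
  define D where "D = inverse (of_nat m) \<cdot>\<^sub>m (A * H')"
  define E where "E = inverse (of_nat m) \<cdot>\<^sub>m (H * mat_adjoint B)"
  have DF: "D \<in> mats_over F m m" and EF: "E \<in> mats_over F m m"
    using A B HF H'F unfolding D_def E_def
    by (auto intro!: smult_mats_over mult_mats_over mat_adjoint_mats_over)
  then have cD: "D \<in> carrier_mat m m" and cE: "E \<in> carrier_mat m m" by (auto simp: mats_over_iff)
  have HH: "H' * H = of_nat m \<cdot>\<^sub>m 1\<^sub>m m"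
    unfolding H'_def H_def by (rule adjoint_mult_haar)
  have scal: "X * (of_nat m \<cdot>\<^sub>m 1\<^sub>m m) = of_nat m \<cdot>\<^sub>m X" if "X \<in> carrier_mat m m" for X :: "complex mat"
    using that mult_smult_distrib[OF that one_carrier_mat] by simp
  have inv_scal: "inverse (of_nat m) \<cdot>\<^sub>m (of_nat m \<cdot>\<^sub>m X) = X" if "X \<in> carrier_mat m m" for X :: "complex mat"
    using \<open>m > 0\<close> by (intro eq_matI) (auto simp flip: mult.assoc)
  have DH: "D * H = A"
  proof -
    have "D * H = inverse (of_nat m) \<cdot>\<^sub>m (A * (H' * H))"
      unfolding D_def using cA H H' mult_smult_assoc_mat[of "A * H'" m m H m]
      by (simp add: assoc_mult_mat[of _ m m _ m _ m])
    then show ?thesis unfolding HH scal[OF cA] inv_scal[OF cA] .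
  qed
  have DE: "D * E = 1\<^sub>m m"
  proof -
    have "D * E = inverse (of_nat m) \<cdot>\<^sub>m (D * (H * mat_adjoint B))"
      unfolding E_def using cD H cB' by (intro mult_smult_distrib) auto
    also have "D * (H * mat_adjoint B) = of_nat m \<cdot>\<^sub>m 1\<^sub>m m"
      using assoc_mult_mat[OF cD H cB'] AB DH by simp
    finally show ?thesis using inv_scal[of "1\<^sub>m m"] by simp
  qed
  then have ED: "E * D = 1\<^sub>m m" using mat_mult_left_right_inverse[OF cD cE] by simp
  \<comment> \<open>Row 0 of the Haar matrix consists of ones, so multiplication by it or its
    adjoint produces row sums.\<close>
  have H0: "H' $$ (s, 0) = 1" "H $$ (0, s) = 1" if "s < m" for s
    using that \<open>m > 0\<close> mat_adjoint_index[OF haar_carrier, of s m 0]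
    by (auto simp: H'_def H_def haar_row_0)
  have D0: "D $$ (i, 0) = (if i = 0 then 1 else 0)" if "i < m" for i
  proof -
    have "D $$ (i, 0) = inverse (of_nat m) * (A * H') $$ (i, 0)"
      using that cA H' \<open>m > 0\<close> by (simp add: D_def)
    also have "(A * H') $$ (i, 0) = (\<Sum>s<m. A $$ (i, s))"
      unfolding index_mult_sum[OF cA H' that \<open>m > 0\<close>] by (intro sum.cong) (auto simp: H0)
    finally show ?thesis using sumA[OF that] \<open>m > 0\<close> by simp
  qed
  have E0: "E $$ (0, j) = (if j = 0 then 1 else 0)" if "j < m" for j
  proof -
    have "E $$ (0, j) = inverse (of_nat m) * (H * mat_adjoint B) $$ (0, j)"
      using that cB' H \<open>m > 0\<close> by (simp add: E_def)
    also have "(H * mat_adjoint B) $$ (0, j) = (\<Sum>s<m. cnj (B $$ (j, s)))"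
      unfolding index_mult_sum[OF H cB' \<open>m > 0\<close> that]
      using that by (intro sum.cong) (auto simp: H0 mat_adjoint_index[OF cB])
    also have "\<dots> = cnj (\<Sum>s<m. B $$ (j, s))" by simp
    finally show ?thesis using sumB[OF that] \<open>m > 0\<close> by simp
  qed
  \<comment> \<open>Column 0 of \<open>D\<close> is a unit vector, so column 0 of \<open>E\<close>
    is column 0 of \<open>E * D = I\<close>. In the same way row 0 of \<open>E\<close> yields row 0
    of \<open>D\<close>.\<close>
  have "E $$ (i, 0) = (if i = 0 then 1 else 0)" if "i < m" for i
  proof -
    have "(E * D) $$ (i, 0) = (\<Sum>s<m. if s = 0 then E $$ (i, s) else 0)"
      unfolding index_mult_sum[OF cE cD that \<open>m > 0\<close>] by (intro sum.cong) (auto simp: D0)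
    then show ?thesis using ED that \<open>m > 0\<close> by (simp add: sum.delta)
  qed
  moreover have "D $$ (0, j) = (if j = 0 then 1 else 0)" if "j < m" for j
  proof -
    have "(E * D) $$ (0, j) = (\<Sum>s<m. if s = 0 then D $$ (s, j) else 0)"
      unfolding index_mult_sum[OF cE cD \<open>m > 0\<close> that] by (intro sum.cong) (auto simp: E0)
    then show ?thesis using ED that \<open>m > 0\<close> by (simp add: sum.delta)
  qed
  moreover define G where "G = mat (m - 1) (m - 1) (\<lambda>(i, j). D $$ (Suc i, Suc j))"
  moreover define K where "K = mat (m - 1) (m - 1) (\<lambda>(i, j). E $$ (Suc i, Suc j))"
  ultimately have DG: "D = diag_one m G" and EK: "E = diag_one m K"
    using diag_one_eqI[OF cD D0 _ \<open>m > 0\<close>] diag_one_eqI[OF cE _ E0 \<open>m > 0\<close>] by auto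
  have cG: "G \<in> carrier_mat (m - 1) (m - 1)" and cK: "K \<in> carrier_mat (m - 1) (m - 1)"
    by (auto simp: G_def K_def)
  have "diag_one m (G * K) = diag_one m (1\<^sub>m (m - 1))" "diag_one m (K * G) = diag_one m (1\<^sub>m (m - 1))"
    using DE ED unfolding DG EK diag_one_mult[OF \<open>m > 0\<close> cG cK] diag_one_mult[OF \<open>m > 0\<close> cK cG]
    by (auto simp: diag_one_one[OF \<open>m > 0\<close>, symmetric])
  then have "G * K = 1\<^sub>m (m - 1)" "K * G = 1\<^sub>m (m - 1)"
    using cG cK by (auto intro!: diag_one_inject[of _ m])
  moreover have "G \<in> mats_over F (m - 1) (m - 1)" "K \<in> mats_over F (m - 1) (m - 1)"
    using DF EF by (auto simp: G_def K_def mats_over_iff)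
  moreover have "A = diag_one m G * haar m" using DH by (simp add: DG H_def)
  ultimately show thesis using that by blast
qed

end

section \<open>Factorizations of wavelet pairs\<close>

abbreviation lmat_eval1 :: "laurent mat \<Rightarrow> complex mat" where
  "lmat_eval1 \<equiv> map_mat laurent_eval1"

lemma lmat_eval1_adjoint:
  assumes A: "A \<in> carrier_mat n k"
  shows "lmat_eval1 (lmat_adjoint A) = mat_adjoint (lmat_eval1 A)"
proof -
  have c: "lmat_eval1 A \<in> carrier_mat n k" using A by simp
  show ?thesis
  proof (rule eq_matI)
    fix i j assume "i < dim_row (mat_adjoint (lmat_eval1 A))" "j < dim_col (mat_adjoint (lmat_eval1 A))"
    then have "i < k" "j < n" using mat_adjoint_carrier[OF c] by auto
    then show "lmat_eval1 (lmat_adjoint A) $$ (i, j) = mat_adjoint (lmat_eval1 A) $$ (i, j)"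
      using A by (simp add: mat_adjoint_index[OF c] lmat_adjoint_def laurent_eval1_star)
  qed (use A mat_adjoint_carrier[OF c] in \<open>auto simp: lmat_adjoint_def\<close>)
qed

lemma lmat_eval1_const: "lmat_eval1 (const_lmat A) = A"
  by (intro eq_matI) (auto simp: const_lmat_def laurent_eval1_single)

lemma laurent_eval1_zpow: "laurent_eval1 (zpow k) = 1"
  by (simp add: zpow_def laurent_eval1_single)

lemma lmat_eval1_lift_L: "N \<in> carrier_mat m m \<Longrightarrow> lmat_eval1 (lift_L m N k) = 1\<^sub>m m"
  unfolding lift_L_eq
  by (intro eq_matI) (auto simp: const_lmat_def laurent_eval1_add laurent_eval1_mult
      laurent_eval1_hom.hom_minus laurent_eval1_zpow)

lemma lmat_eval1_lift_R: "N \<in> carrier_mat m m \<Longrightarrow> lmat_eval1 (lift_R m N k) = 1\<^sub>m m"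
  using mat_adjoint_carrier[of N m m] unfolding lift_R_eq
  by (intro eq_matI) (auto simp: const_lmat_def laurent_eval1_add laurent_eval1_mult
      laurent_eval1_hom.hom_minus laurent_eval1_zpow)

lemma lmat_eval1_primitive_paraunitary: "primitive_paraunitary F m V \<Longrightarrow> lmat_eval1 V = 1\<^sub>m m"
  unfolding primitive_paraunitary_lift
  by (auto simp: unit_vec_over_def vecs_over_def intro!: lmat_eval1_lift_L outer_self_carrier)

lemma lmat_prod_carrier: "\<forall>A\<in>set As. A \<in> carrier_mat m m \<Longrightarrow> lmat_prod m As \<in> carrier_mat m m"
  unfolding lmat_prod_def by (induction As) auto

lemma lmat_eval1_lmat_prod:
  "\<forall>A\<in>set As. A \<in> carrier_mat m m \<and> lmat_eval1 A = 1\<^sub>m m \<Longrightarrow> lmat_eval1 (lmat_prod m As) = 1\<^sub>m m"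
proof (induction As)
  case Nil
  then show ?case by (simp add: lmat_prod_def laurent_eval1_hom.mat_hom_one)
next
  case (Cons A As)
  then have "lmat_prod m As \<in> carrier_mat m m" "A \<in> carrier_mat m m" by (auto intro: lmat_prod_carrier)
  moreover have "lmat_prod m (A # As) = A * lmat_prod m As" by (simp add: lmat_prod_def)
  ultimately show ?case using Cons by (simp add: laurent_eval1_hom.mat_hom_mult[of _ m m])
qed

lemma lmat_of_poly_prod:
  "\<forall>A\<in>set As. A \<in> carrier_mat m m \<Longrightarrow> foldr (*) As (1\<^sub>m m) \<in> carrier_mat m m \<and>
    map_mat laurent_of_poly (foldr (*) As (1\<^sub>m m)) = lmat_prod m (map (map_mat laurent_of_poly) As)"
  unfolding lmat_prod_def
  by (induction As) (auto simp: laurent_of_poly_hom.mat_hom_one laurent_of_poly_hom.mat_hom_mult[of _ m m])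

text \<open>The adjoint reverses products, so the inner pair \<open>A'\<close>, \<open>B'\<close>
  meets first and leaves a scalar, which passes through the outer pair.\<close>

lemma mult_lmat_adjoint_mult:
  assumes c: "A \<in> carrier_mat m m" "B \<in> carrier_mat m m" "A' \<in> carrier_mat m m" "B' \<in> carrier_mat m m"
    and AB: "A * lmat_adjoint B = 1\<^sub>m m" and AB': "A' * lmat_adjoint B' = c \<cdot>\<^sub>m 1\<^sub>m m"
  shows "(A * A') * lmat_adjoint (B * B') = c \<cdot>\<^sub>m 1\<^sub>m m"
proof -
  note c' = lmat_adjoint_carrier[OF c(2)] lmat_adjoint_carrier[OF c(4)]
  have "(A * A') * lmat_adjoint (B * B') = A * ((A' * lmat_adjoint B') * lmat_adjoint B)"
    unfolding lmat_adjoint_mult[OF c(2,4)] using c c' by (simp add: assoc_mult_mat[of _ m m _ m _ m])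
  also have "(A' * lmat_adjoint B') * lmat_adjoint B = c \<cdot>\<^sub>m lmat_adjoint B"
    unfolding AB' using mult_smult_assoc_mat[OF one_carrier_mat c'(1)] c' by simp
  finally show ?thesis using mult_smult_distrib[OF c(1) c'(1)] AB by simp
qed

lemma lmat_prod_mult_adjoint:
  assumes "\<forall>x\<in>set xs. A x \<in> carrier_mat m m \<and> B x \<in> carrier_mat m m \<and> A x * lmat_adjoint (B x) = 1\<^sub>m m"
  shows "lmat_prod m (map A xs) * lmat_adjoint (lmat_prod m (map B xs)) = 1\<^sub>m m"
  using assms
proof (induction xs)
  case Nil
  have "lmat_adjoint (1\<^sub>m m) = 1\<^sub>m m"
    by (intro eq_matI) (auto simp: lmat_adjoint_def laurent_star_0 laurent_star_1)
  then show ?case by (simp add: lmat_prod_def)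
next
  case (Cons x xs)
  have "lmat_prod m (map A xs) \<in> carrier_mat m m" "lmat_prod m (map B xs) \<in> carrier_mat m m"
    using Cons.prems by (auto intro!: lmat_prod_carrier)
  moreover have one: "1 \<cdot>\<^sub>m 1\<^sub>m m = (1\<^sub>m m :: laurent mat)" by (intro eq_matI) auto
  ultimately show ?case
    using mult_lmat_adjoint_mult[of "A x" m "B x" "lmat_prod m (map A xs)" "lmat_prod m (map B xs)" 1,
        unfolded one] Cons
    by (simp add: lmat_prod_def)
qed

text \<open>Serves both directions: it carries the converse, and for a given pair it shows that the
  matrix assembled from the factors of \<open>L\<close> is a partner of \<open>L\<close>. Each
  factor cancels against its own partner, \<open>z\<^sup>l\<close> against its adjoint, and the Haar
  matrix contributes the scalar \<open>m\<close>.\<close>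

lemma factorization_biorthogonal:
  fixes G K :: "complex mat"
  assumes "m > 0" and V: "\<forall>i\<in>set is. primitive_paraunitary F m (V i)"
    and N: "\<forall>i\<in>set js. N i \<in> carrier_mat m m \<and> N i * N i = 0\<^sub>m m m"
    and G: "G \<in> carrier_mat (m - 1) (m - 1)" and K: "K \<in> carrier_mat (m - 1) (m - 1)"
    and GK: "G * K = 1\<^sub>m (m - 1)"
    and L: "L = zpow l \<cdot>\<^sub>m (lmat_prod m (map V is) * lmat_prod m (map (\<lambda>i. lift_L m (N i) (k i)) js) *
      const_lmat (diag_one m G) * const_lmat (haar m))"
    and R: "R = zpow l \<cdot>\<^sub>m (lmat_prod m (map V is) * lmat_prod m (map (\<lambda>i. lift_R m (N i) (k i)) js) *
      const_lmat (diag_one m (mat_adjoint K)) * const_lmat (haar m))"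
  shows "L \<in> carrier_mat m m" and "R \<in> carrier_mat m m"
    and "L * lmat_adjoint R = of_nat m \<cdot>\<^sub>m 1\<^sub>m m"
    and "lmat_eval1 L = diag_one m G * haar m"
    and "lmat_eval1 R = diag_one m (mat_adjoint K) * haar m"
proof -
  define P where "P = lmat_prod m (map V is)"
  define X where "X = lmat_prod m (map (\<lambda>i. lift_L m (N i) (k i)) js)"
  define Y where "Y = lmat_prod m (map (\<lambda>i. lift_R m (N i) (k i)) js)"
  define S where "S = diag_one m G * haar m"
  define T where "T = diag_one m (mat_adjoint K) * haar m"
  note H = haar_carrier[of m] and H' = mat_adjoint_carrier[OF haar_carrier[of m]]
  note dG = diag_one_carrier[OF \<open>m > 0\<close> G] and dK = diag_one_carrier[OF \<open>m > 0\<close> K]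
    and dK' = diag_one_carrier[OF \<open>m > 0\<close> mat_adjoint_carrier[OF K]]
  have P: "P \<in> carrier_mat m m" unfolding P_def
    using V by (intro lmat_prod_carrier) (auto intro: primitive_paraunitary_carrier)
  have X: "X \<in> carrier_mat m m" and Y: "Y \<in> carrier_mat m m" unfolding X_def Y_def
    using N by (auto intro!: lmat_prod_carrier lift_L_carrier lift_R_carrier)
  have S: "S \<in> carrier_mat m m" and T: "T \<in> carrier_mat m m"
    using dG dK' H by (auto simp: S_def T_def)
  note cS = const_lmat_carrier[OF S] and cT = const_lmat_carrier[OF T]
  have L': "L = zpow l \<cdot>\<^sub>m (P * (X * const_lmat S))" and R': "R = zpow l \<cdot>\<^sub>m (P * (Y * const_lmat T))"
    unfolding L R P_def[symmetric] X_def[symmetric] Y_def[symmetric] S_def T_def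
      const_lmat_mult[OF dG H] const_lmat_mult[OF dK' H]
    using P X Y const_lmat_carrier[OF dG] const_lmat_carrier[OF dK'] const_lmat_carrier[OF H]
    by (simp_all add: assoc_mult_mat[of _ m m _ m _ m])
  show cL: "L \<in> carrier_mat m m" and cR: "R \<in> carrier_mat m m"
    using P X Y cS cT by (auto simp: L' R')
  have PP: "P * lmat_adjoint P = 1\<^sub>m m" unfolding P_def
    using V by (intro lmat_prod_mult_adjoint)
      (auto intro: primitive_paraunitary_carrier primitive_paraunitary_mult_adjoint)
  have XY: "X * lmat_adjoint Y = 1\<^sub>m m" unfolding X_def Y_def
    using N by (intro lmat_prod_mult_adjoint)
      (auto intro: lift_L_carrier lift_R_carrier lift_L_mult_adjoint_lift_R)
  have "mat_adjoint T = mat_adjoint (haar m) * diag_one m K"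
    unfolding T_def mat_adjoint_mult[OF dK' H] mat_adjoint_diag_one[OF \<open>m > 0\<close> mat_adjoint_carrier[OF K]]
      mat_adjoint_adjoint ..
  then have "S * mat_adjoint T = diag_one m G * ((haar m * mat_adjoint (haar m)) * diag_one m K)"
    unfolding S_def using dG dK H H' by (simp add: assoc_mult_mat[of _ m m _ m _ m])
  also have "(haar m * mat_adjoint (haar m)) * diag_one m K = of_nat m \<cdot>\<^sub>m diag_one m K"
    unfolding haar_mult_adjoint using mult_smult_assoc_mat[OF one_carrier_mat dK] dK by simp
  also have "diag_one m G * (of_nat m \<cdot>\<^sub>m diag_one m K) = of_nat m \<cdot>\<^sub>m 1\<^sub>m m"
    using mult_smult_distrib[OF dG dK] diag_one_mult[OF \<open>m > 0\<close> G K] GK diag_one_one[OF \<open>m > 0\<close>] by simp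
  finally have "S * mat_adjoint T = of_nat m \<cdot>\<^sub>m 1\<^sub>m m" .
  then have ST: "const_lmat S * lmat_adjoint (const_lmat T) = of_nat m \<cdot>\<^sub>m 1\<^sub>m m"
    unfolding lmat_adjoint_const const_lmat_mult[OF S mat_adjoint_carrier[OF T], symmetric]
    by (intro eq_matI) (auto simp: const_lmat_def)
  have "P * (X * const_lmat S) * lmat_adjoint (P * (Y * const_lmat T)) = of_nat m \<cdot>\<^sub>m 1\<^sub>m m"
    using P X Y cS cT
    by (intro mult_lmat_adjoint_mult[OF _ _ _ _ PP] mult_lmat_adjoint_mult[OF _ _ _ _ XY ST]) auto
  moreover have "lmat_adjoint R = zpow (- l) \<cdot>\<^sub>m lmat_adjoint (P * (Y * const_lmat T))"
    unfolding R' by (intro eq_matI) (auto simp: lmat_adjoint_def laurent_star_mult laurent_star_zpow)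
  ultimately have "L * lmat_adjoint R = zpow (- l) \<cdot>\<^sub>m (zpow l \<cdot>\<^sub>m (of_nat m \<cdot>\<^sub>m 1\<^sub>m m))"
    unfolding L' using P X Y cS cT lmat_adjoint_carrier[of "P * (Y * const_lmat T)" m m]
    by (simp add: mult_smult_distrib[of _ m m _ m] mult_smult_assoc_mat[of _ m m _ m])
  then show "L * lmat_adjoint R = of_nat m \<cdot>\<^sub>m 1\<^sub>m m"
    by (auto intro!: eq_matI simp: zpow_mult zpow_0 simp flip: mult.assoc)
  have eP: "lmat_eval1 P = 1\<^sub>m m" unfolding P_def
    using V by (intro lmat_eval1_lmat_prod) (auto intro: primitive_paraunitary_carrier lmat_eval1_primitive_paraunitary)
  have eX: "lmat_eval1 X = 1\<^sub>m m" unfolding X_def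
    using N by (intro lmat_eval1_lmat_prod) (auto intro: lift_L_carrier lmat_eval1_lift_L)
  have eY: "lmat_eval1 Y = 1\<^sub>m m" unfolding Y_def
    using N by (intro lmat_eval1_lmat_prod) (auto intro: lift_R_carrier lmat_eval1_lift_R)
  have smult: "lmat_eval1 (zpow l \<cdot>\<^sub>m A) = lmat_eval1 A" for A
    by (intro eq_matI) (auto simp: laurent_eval1_mult laurent_eval1_zpow)
  have XS: "X * const_lmat S \<in> carrier_mat m m" and YT: "Y * const_lmat T \<in> carrier_mat m m"
    using X Y cS cT by auto
  show "lmat_eval1 L = S" "lmat_eval1 R = T"
    unfolding L' R' smult laurent_eval1_hom.mat_hom_mult[OF P XS] laurent_eval1_hom.mat_hom_mult[OF P YT]
      laurent_eval1_hom.mat_hom_mult[OF X cS] laurent_eval1_hom.mat_hom_mult[OF Y cT]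
      lmat_eval1_const eP eX eY using S T by auto
qed

section \<open>Row sums of block matrices, genus and cancellation\<close>

lemma blocks_to_lmat_carrier: "blocks_to_lmat m g L \<in> carrier_mat m m"
  by (simp add: blocks_to_lmat_def)

lemma lmat_eval1_blocks:
  "i < m \<Longrightarrow> j < m \<Longrightarrow> lmat_eval1 (blocks_to_lmat m g L) $$ (i, j) = (\<Sum>k<g. L $$ (i, k * m + j))"
  by (simp add: blocks_to_lmat_def laurent_eval1_hom.hom_sum laurent_eval1_single)

text \<open>Setting \<open>z = 1\<close> adds up the blocks, and column \<open>k * m + j\<close> is
  column \<open>j\<close> of block \<open>k\<close>. So the row sums in the definition of a pair are
  conditions on the value at 1.\<close>

lemma lmat_eval1_blocks_row_sum:
  assumes "i < m"
  shows "(\<Sum>j<m. lmat_eval1 (blocks_to_lmat m g L) $$ (i, j)) = (\<Sum>j<m * g. L $$ (i, j))"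
proof -
  have "(\<Sum>j<m. lmat_eval1 (blocks_to_lmat m g L) $$ (i, j)) = (\<Sum>j<m. \<Sum>k<g. L $$ (i, k * m + j))"
    using assms by (intro sum.cong) (auto simp: lmat_eval1_blocks)
  also have "\<dots> = (\<Sum>k<g. \<Sum>j<m. L $$ (i, k * m + j))" by (rule sum.swap)
  also have "\<dots> = (\<Sum>k<g. \<Sum>j = k * m..<k * m + m. L $$ (i, j))"
  proof (rule sum.cong)
    fix k
    show "(\<Sum>j<m. L $$ (i, k * m + j)) = (\<Sum>j = k * m..<k * m + m. L $$ (i, j))"
      using sum.shift_bounds_nat_ivl[of "\<lambda>j. L $$ (i, j)" 0 "k * m" m]
      by (simp add: atLeast0LessThan add.commute)
  qed simp
  also have "\<dots> = (\<Sum>j<m * g. L $$ (i, j))"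
    by (simp add: sum.nat_group mult.commute)
  finally show ?thesis .
qed

lemma biorthogonal_wavelet_pair_eval1:
  "biorthogonal_wavelet_pair m g L R \<longleftrightarrow>
     blocks_to_lmat m g L * lmat_adjoint (blocks_to_lmat m g R) = of_nat m \<cdot>\<^sub>m 1\<^sub>m m \<and>
     (\<forall>i<m. (\<Sum>j<m. lmat_eval1 (blocks_to_lmat m g L) $$ (i, j)) = (if i = 0 then of_nat m else 0) \<and>
       (\<Sum>j<m. lmat_eval1 (blocks_to_lmat m g R) $$ (i, j)) = (if i = 0 then of_nat m else 0))"
  unfolding biorthogonal_wavelet_pair_def by (simp only: lmat_eval1_blocks_row_sum cong: conj_cong imp_cong)

text \<open>All rows of the Haar matrix but row 0 sum to zero, so only column 0 of the block matrix
  is seen.\<close>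

lemma diag_one_haar_row_sum:
  assumes G: "G \<in> carrier_mat (m - 1) (m - 1)" and i: "i < m"
  shows "(\<Sum>j<m. (diag_one m G * haar m) $$ (i, j)) = (if i = 0 then of_nat m else 0)"
proof -
  have "m > 0" using i by simp
  note D = diag_one_carrier[OF this G]
  have "(\<Sum>j<m. (diag_one m G * haar m) $$ (i, j)) =
      (\<Sum>j<m. \<Sum>s<m. diag_one m G $$ (i, s) * haar m $$ (s, j))"
    using i by (intro sum.cong) (auto simp: index_mult_sum[OF D haar_carrier])
  also have "\<dots> = (\<Sum>s<m. diag_one m G $$ (i, s) * (\<Sum>j<m. haar m $$ (s, j)))"
    unfolding sum_distrib_left by (rule sum.swap)
  also have "\<dots> = (\<Sum>s<m. if s = 0 then diag_one m G $$ (i, s) * of_nat m else 0)"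
    by (intro sum.cong) (auto simp: haar_row_sum)
  also have "\<dots> = (if i = 0 then of_nat m else 0)"
    using i by (simp add: sum.delta diag_one_index[OF G])
  finally show ?thesis .
qed

text \<open>The support lies in \<open>{0..int g - 1}\<close>. It is nonempty for a nonzero matrix,
  so its \<open>Max\<close> and \<open>Min\<close> are members of it.\<close>

lemma lmat_genus_of_poly_le:
  fixes P :: "complex poly mat"
  assumes P: "P \<in> carrier_mat m m" and "P \<noteq> 0\<^sub>m m m" and "g > 0"
    and deg: "\<And>i j. i < m \<Longrightarrow> j < m \<Longrightarrow> degree (P $$ (i, j)) \<le> g - 1"
  shows "lmat_genus (map_mat laurent_of_poly P) \<le> int g"
proof -
  let ?A = "map_mat laurent_of_poly P"
  have coeff: "lmat_coeff ?A k $$ (i, j) = (if k < 0 then 0 else coeff (P $$ (i, j)) (nat k))"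
    if "i < m" "j < m" for i j k
    using that P lookup_laurent_of_poly by (simp add: lmat_coeff_def)
  have dims: "lmat_coeff ?A k \<in> carrier_mat m m" for k using P by (simp add: lmat_coeff_def)
  have "lmat_support ?A \<subseteq> {0..int g - 1}"
  proof
    fix k assume "k \<in> lmat_support ?A"
    then have "lmat_coeff ?A k \<noteq> 0\<^sub>m m m" using P by (simp add: lmat_support_def)
    then obtain i j where ij: "i < m" "j < m" "lmat_coeff ?A k $$ (i, j) \<noteq> 0"
      using dims[of k] by (metis carrier_matD eq_matI index_zero_mat)
    then have "k \<ge> 0" "coeff (P $$ (i, j)) (nat k) \<noteq> 0" using coeff by (auto split: if_splits)
    then have "nat k \<le> g - 1" using le_degree deg[OF ij(1,2)] by (metis order.trans)
    then show "k \<in> {0..int g - 1}" using \<open>k \<ge> 0\<close> \<open>g > 0\<close> by auto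
  qed
  moreover have "lmat_support ?A \<noteq> {}"
  proof -
    obtain i j where ij: "i < m" "j < m" "P $$ (i, j) \<noteq> 0"
      using P \<open>P \<noteq> 0\<^sub>m m m\<close> by (metis carrier_matD eq_matI index_zero_mat)
    define n where "n = int (degree (P $$ (i, j)))"
    have "lmat_coeff ?A n $$ (i, j) \<noteq> 0" using ij coeff by (simp add: n_def)
    then have "n \<in> lmat_support ?A" using P ij by (auto simp: lmat_support_def)
    then show ?thesis by blast
  qed
  moreover have "finite (lmat_support ?A)" using calculation(1) by (rule finite_subset) simp
  ultimately have "Max (lmat_support ?A) \<in> {0..int g - 1}" "Min (lmat_support ?A) \<in> {0..int g - 1}"
    using Max_in Min_in by blast+
  then show ?thesis unfolding lmat_genus_def by auto
qed


text \<open>Multiplication by the adjugate leaves the scalar \<open>det A\<close> to be cancelled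
  entrywise, for which it has to be nonzero but not a unit.\<close>

lemma lmat_mult_left_cancel:
  fixes A X Y :: "laurent mat"
  assumes A: "A \<in> carrier_mat m m" and X: "X \<in> carrier_mat m m" and Y: "Y \<in> carrier_mat m m"
    and "A * X = A * Y" and "det A \<noteq> 0"
  shows "X = Y"
proof -
  have "det A \<cdot>\<^sub>m Z = adj_mat A * (A * Z)" if "Z \<in> carrier_mat m m" for Z
    using that adj_mat[OF A] A assoc_mult_mat[of "adj_mat A" m m A m Z m]
      mult_smult_assoc_mat[of "1\<^sub>m m" m m Z m "det A"] by simp
  then have eq: "det A \<cdot>\<^sub>m X = det A \<cdot>\<^sub>m Y" using assms by simp
  show ?thesis
  proof (rule eq_matI)
    fix i j assume "i < dim_row Y" "j < dim_col Y"
    then show "X $$ (i, j) = Y $$ (i, j)"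
      using arg_cong[OF eq, of "\<lambda>Z. Z $$ (i, j)"] X Y \<open>det A \<noteq> 0\<close> by simp
  qed (use X Y in auto)
qed

section \<open>The determinant of a pair is a monomial\<close>

definition blocks_to_pmat :: "nat \<Rightarrow> nat \<Rightarrow> complex mat \<Rightarrow> complex poly mat" where
  "blocks_to_pmat m g L = mat m m (\<lambda>(i, j). \<Sum>k<g. monom (L $$ (i, k * m + j)) k)"

lemma lmat_of_poly_blocks: "map_mat laurent_of_poly (blocks_to_pmat m g L) = blocks_to_lmat m g L"
  unfolding blocks_to_pmat_def blocks_to_lmat_def
  by (intro eq_matI) (auto simp: laurent_of_poly_hom.hom_sum laurent_of_poly_monom)

lemma blocks_to_pmat_carrier: "blocks_to_pmat m g L \<in> carrier_mat m m"
  by (simp add: blocks_to_pmat_def)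

lemma degree_blocks_to_pmat:
  "i < m \<Longrightarrow> j < m \<Longrightarrow> degree (blocks_to_pmat m g L $$ (i, j)) \<le> g - 1"
  by (auto simp: blocks_to_pmat_def intro!: degree_sum_le order.trans[OF degree_monom_le])

text \<open>Multiplying the adjoint of \<open>R(z)\<close> by a power of \<open>z\<^sup>-\<^sup>1\<close> makes it polynomial in \<open>z\<^sup>-\<^sup>1\<close>, so the
  determinant of \<open>L(z)\<close> divides a monomial.\<close>

lemma det_blocks_to_pmat:
  assumes "g > 0" and "m > 0"
    and LR: "blocks_to_lmat m g L * lmat_adjoint (blocks_to_lmat m g R) = of_nat m \<cdot>\<^sub>m 1\<^sub>m m"
  shows "\<exists>c b. c \<noteq> 0 \<and> det (blocks_to_pmat m g L) = monom c b"
proof -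
  define Lp where "Lp = blocks_to_pmat m g L"
  \<comment> \<open>This is \<open>w\<^sup>g\<^sup>-\<^sup>1\<close> times the adjoint of
    \<open>R\<close>: block \<open>k\<close> stands there at \<open>z\<^sup>k\<close> and moves to
    the exponent \<open>g - 1 - k\<close> of \<open>w\<close>, a true difference for
    \<open>k < g\<close>.\<close>
  define Q where "Q = mat m m (\<lambda>(i, j). \<Sum>k<g. monom (cnj (R $$ (j, k * m + i))) (g - 1 - k))"
  define R' where "R' = lmat_adjoint (blocks_to_lmat m g R)"
  have cL: "Lp \<in> carrier_mat m m" and cQ: "Q \<in> carrier_mat m m" and cR': "R' \<in> carrier_mat m m"
    by (auto simp: Lp_def Q_def R'_def blocks_to_pmat_carrier intro: lmat_adjoint_carrier blocks_to_lmat_carrier)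
  have Q: "map_mat laurent_of_poly Q = zpow (1 - int g) \<cdot>\<^sub>m R'"
  proof (rule eq_matI)
    fix i j assume "i < dim_row (zpow (1 - int g) \<cdot>\<^sub>m R')" "j < dim_col (zpow (1 - int g) \<cdot>\<^sub>m R')"
    then have ij: "i < m" "j < m" using cR' by auto
    have "map_mat laurent_of_poly Q $$ (i, j) =
        (\<Sum>k<g. Poly_Mapping.single (- int (g - 1 - k)) (cnj (R $$ (j, k * m + i))))"
      using ij by (simp add: Q_def laurent_of_poly_hom.hom_sum laurent_of_poly_monom)
    also have "\<dots> = (\<Sum>k<g. zpow (1 - int g) * Poly_Mapping.single (int k) (cnj (R $$ (j, k * m + i))))"
      by (intro sum.cong) (auto simp: zpow_def mult_single of_nat_diff algebra_simps)
    also have "\<dots> = (zpow (1 - int g) \<cdot>\<^sub>m R') $$ (i, j)"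
      using ij unfolding R'_def
      by (simp add: lmat_adjoint_def blocks_to_lmat_def laurent_star_sum laurent_star_single sum_distrib_left)
    finally show "map_mat laurent_of_poly Q $$ (i, j) = (zpow (1 - int g) \<cdot>\<^sub>m R') $$ (i, j)" .
  qed (use cQ cR' in auto)
  have "map_mat laurent_of_poly (Lp * Q) = zpow (1 - int g) \<cdot>\<^sub>m (of_nat m \<cdot>\<^sub>m 1\<^sub>m m)"
    unfolding laurent_of_poly_hom.mat_hom_mult[OF cL cQ] Q
    using mult_smult_distrib[of "map_mat laurent_of_poly Lp" m m R' m] cL cR' LR
    by (simp add: Lp_def R'_def lmat_of_poly_blocks blocks_to_lmat_carrier)
  also have "\<dots> = map_mat laurent_of_poly (monom (of_nat m) (g - 1) \<cdot>\<^sub>m 1\<^sub>m m)"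
    using \<open>g > 0\<close>
    by (intro eq_matI) (auto simp: laurent_of_poly_mult laurent_of_poly_monom laurent_of_poly_0
        zpow_def mult_single of_nat_diff simp flip: single_of_nat)
  finally have eq: "map_mat laurent_of_poly (Lp * Q) = map_mat laurent_of_poly (monom (of_nat m) (g - 1) \<cdot>\<^sub>m 1\<^sub>m m)" .
  have "Lp * Q = monom (of_nat m) (g - 1) \<cdot>\<^sub>m 1\<^sub>m m"
  proof (rule eq_matI)
    fix i j assume "i < dim_row (monom (of_nat m) (g - 1) \<cdot>\<^sub>m 1\<^sub>m m :: complex poly mat)"
      "j < dim_col (monom (of_nat m) (g - 1) \<cdot>\<^sub>m 1\<^sub>m m :: complex poly mat)"
    then have ij: "i < m" "j < m" by auto
    have "map_mat laurent_of_poly (Lp * Q) $$ (i, j) = laurent_of_poly ((Lp * Q) $$ (i, j))"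
      "map_mat laurent_of_poly (monom (of_nat m) (g - 1) \<cdot>\<^sub>m 1\<^sub>m m) $$ (i, j) =
        laurent_of_poly ((monom (of_nat m) (g - 1) \<cdot>\<^sub>m 1\<^sub>m m) $$ (i, j))"
      using ij cL cQ by (auto simp del: index_mult_mat(1) index_smult_mat(1))
    then show "(Lp * Q) $$ (i, j) = (monom (of_nat m) (g - 1) \<cdot>\<^sub>m 1\<^sub>m m) $$ (i, j)"
      unfolding eq by (simp only: laurent_of_poly_inject)
  qed (use cL cQ in auto)
  then have "det Lp * det Q = monom (of_nat m) (g - 1) ^ m"
    using det_mult[OF cL cQ] by simp
  then have "det Lp * det Q = monom (of_nat m ^ m) ((g - 1) * m)"
    by (simp add: monom_power)
  then show ?thesis unfolding Lp_def using \<open>m > 0\<close> by (intro mult_eq_monomD) auto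
qed

section \<open>Assembling the factorization\<close>

context conj_closed_subfield
begin

text \<open>Only \<open>L\<close> is factored. The choice \<open>k\<^sub>0 = 0\<close> is built in:
  the length of \<open>vs\<close> is both the number of primitive factors and the exponent of the
  determinant.\<close>

lemma wavelet_factorization:
  assumes "haar_over F m" and "normalizable_over F m" and "m > 0"
    and LF: "L \<in> mats_over F m (m * g)" and RF: "R \<in> mats_over F m (m * g)"
    and bio: "biorthogonal_wavelet_pair m g L R"
  obtains c vs fs G K where "c \<noteq> 0"
    "det (blocks_to_lmat m g L) = Poly_Mapping.single (- int (length vs)) c"
    "\<forall>v\<in>set vs. unit_vec_over F m v"
    "\<forall>(N, k)\<in>set fs. N \<in> mats_over F m m \<and> N * N = 0\<^sub>m m m \<and> k > 0"
    "G \<in> mats_over F (m - 1) (m - 1)" "K \<in> mats_over F (m - 1) (m - 1)"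
    "G * K = 1\<^sub>m (m - 1)" "K * G = 1\<^sub>m (m - 1)"
    "lmat_genus (lmat_prod m (map (\<lambda>(N, k). lift_L m N k) fs)) \<le> int g"
    "blocks_to_lmat m g L = lmat_prod m (map (\<lambda>v. lift_L m (outer_self v) 1) vs) *
      lmat_prod m (map (\<lambda>(N, k). lift_L m N k) fs) * const_lmat (diag_one m G) * const_lmat (haar m)"
proof -
  define LL where "LL = blocks_to_lmat m g L"
  define RR where "RR = blocks_to_lmat m g R"
  define EL where "EL = lmat_eval1 LL"
  define ER where "ER = lmat_eval1 RR"
  have cL: "LL \<in> carrier_mat m m" and cR: "RR \<in> carrier_mat m m"
    by (auto simp: LL_def RR_def blocks_to_lmat_carrier)
  have LR: "LL * lmat_adjoint RR = of_nat m \<cdot>\<^sub>m 1\<^sub>m m"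
    and sumL: "\<And>i. i < m \<Longrightarrow> (\<Sum>j<m. EL $$ (i, j)) = (if i = 0 then of_nat m else 0)"
    and sumR: "\<And>i. i < m \<Longrightarrow> (\<Sum>j<m. ER $$ (i, j)) = (if i = 0 then of_nat m else 0)"
    using bio unfolding biorthogonal_wavelet_pair_eval1 by (auto simp: LL_def RR_def EL_def ER_def)
  \<comment> \<open>For \<open>g = 0\<close> row 0 would have an empty sum, which cannot equal
    \<open>m\<close>. Positivity keeps the bound \<open>g - 1\<close> meaningful.\<close>
  have "g > 0"
  proof (rule ccontr)
    assume "\<not> g > 0"
    then have "(\<Sum>j<m. EL $$ (0, j)) = 0"
      using lmat_eval1_blocks_row_sum[OF \<open>m > 0\<close>, of g L] by (simp add: EL_def LL_def)
    then show False using sumL[OF \<open>m > 0\<close>] \<open>m > 0\<close> by simp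
  qed
  have index: "k * m + j < m * g" if "k < g" "j < m" for k j
  proof -
    have "k * m + j < Suc k * m" using that by simp
    also have "\<dots> \<le> g * m" using that by (intro mult_le_mono1) simp
    finally show ?thesis by (simp add: mult.commute)
  qed
  have blockF: "A $$ (i, k * m + j) \<in> F" if "A \<in> mats_over F m (m * g)" "i < m" "j < m" "k < g" for A i j k
    using that index by (auto simp: mats_over_iff)
  have EF: "lmat_eval1 (blocks_to_lmat m g A) \<in> mats_over F m m" if "A \<in> mats_over F m (m * g)" for A
    unfolding mats_over_iff using blockF[OF that] blocks_to_lmat_carrier[of m g A]
    by (auto simp: lmat_eval1_blocks simp del: index_map_mat(1) intro!: sum_in)
  have ELR: "EL * mat_adjoint ER = of_nat m \<cdot>\<^sub>m 1\<^sub>m m"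
  proof -
    have "EL * mat_adjoint ER = lmat_eval1 (LL * lmat_adjoint RR)"
      unfolding EL_def ER_def lmat_eval1_adjoint[OF cR, symmetric]
        laurent_eval1_hom.mat_hom_mult[OF cL lmat_adjoint_carrier[OF cR]] ..
    also have "\<dots> = of_nat m \<cdot>\<^sub>m 1\<^sub>m m"
      unfolding LR by (intro eq_matI) (auto simp: laurent_eval1_mult laurent_eval1_hom.hom_of_nat)
    finally show ?thesis .
  qed
  obtain G K where GK: "G \<in> mats_over F (m - 1) (m - 1)" "K \<in> mats_over F (m - 1) (m - 1)"
    "G * K = 1\<^sub>m (m - 1)" "K * G = 1\<^sub>m (m - 1)" and EL: "EL = diag_one m G * haar m"
    using haar_factorization[OF \<open>m > 0\<close> \<open>haar_over F m\<close> _ _ ELR sumL sumR] EF[OF LF] EF[OF RF]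
    unfolding EL_def ER_def LL_def RR_def by blast
  define Lp where "Lp = blocks_to_pmat m g L"
  have cLp: "Lp \<in> carrier_mat m m" by (simp add: Lp_def blocks_to_pmat_carrier)
  have LpF: "coeff (Lp $$ (i, j)) k \<in> F" if "i < m" "j < m" for i j k
    using that blockF[OF LF] by (auto simp: Lp_def blocks_to_pmat_def coeff_sum intro!: sum_in)
  obtain c b where c: "c \<noteq> 0" "det Lp = monom c b"
    using det_blocks_to_pmat[OF \<open>g > 0\<close> \<open>m > 0\<close>] LR unfolding Lp_def LL_def RR_def by blast
  have detL: "det LL = Poly_Mapping.single (- int b) c"
    unfolding LL_def lmat_of_poly_blocks[symmetric] Lp_def[symmetric] laurent_of_poly_hom.hom_det c(2)
    by (rule laurent_of_poly_monom)
  obtain vs C where vs: "length vs = b" "\<forall>v\<in>set vs. unit_vec_over F m v"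
    and Lp: "Lp = foldr (*) (map (\<lambda>v. poly_lift m (outer_self v) 1) vs) (1\<^sub>m m) * C"
    and C: "C \<in> carrier_mat m m" "\<forall>i<m. \<forall>j<m. \<forall>k. coeff (C $$ (i, j)) k \<in> F"
      "\<forall>i<m. \<forall>j<m. degree (C $$ (i, j)) \<le> g - 1" and detC: "det C = [:c:]"
    using split_primitive_factors[OF \<open>normalizable_over F m\<close> cLp LpF, of "g - 1" c b] c(2)
      degree_blocks_to_pmat[of _ m _ g L] unfolding Lp_def by blast
  have "C \<in> lift_products m"
    using C unimodular_in_lift_products[of C m "\<lambda>_. g - 1" c] detC c(1) by blast
  then obtain fs S T where fs: "\<forall>(N, k)\<in>set fs. N \<in> mats_over F m m \<and> N * N = 0\<^sub>m m m \<and> k > 0"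
    and ST: "S \<in> mats_over F m m" "T \<in> mats_over F m m" "S * T = 1\<^sub>m m"
    and CS: "C = foldr (*) (map (\<lambda>(N, k). poly_lift m N k) fs) (1\<^sub>m m) * const_pmat S"
    using lift_products_factorization by meson
  define V where "V = foldr (*) (map (\<lambda>v. poly_lift m (outer_self v) 1) vs) (1\<^sub>m m)"
  define P where "P = foldr (*) (map (\<lambda>(N, k). poly_lift m N k) fs) (1\<^sub>m m)"
  define VL where "VL = lmat_prod m (map (\<lambda>v. lift_L m (outer_self v) 1) vs)"
  define PL where "PL = lmat_prod m (map (\<lambda>(N, k). lift_L m N k) fs)"
  have S: "S \<in> carrier_mat m m" and T: "T \<in> carrier_mat m m" using ST by (auto simp: mats_over_iff)
  have outer: "outer_self v \<in> carrier_mat m m" if "v \<in> set vs" for v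
    using that vs(2) by (auto simp: unit_vec_over_def vecs_over_def intro: outer_self_carrier)
  have nilp: "N \<in> carrier_mat m m" if "(N, k) \<in> set fs" for N k
    using that fs by (auto simp: mats_over_iff)
  have map_V: "map (map_mat laurent_of_poly) (map (\<lambda>v. poly_lift m (outer_self v) 1) vs) =
      map (\<lambda>v. lift_L m (outer_self v) 1) vs"
    using outer by (auto simp: lmat_of_poly_lift)
  have map_P: "map (map_mat laurent_of_poly) (map (\<lambda>(N, k). poly_lift m N k) fs) =
      map (\<lambda>(N, k). lift_L m N k) fs"
    using nilp by (auto simp: lmat_of_poly_lift)
  have "V \<in> carrier_mat m m \<and> map_mat laurent_of_poly V = VL"
    unfolding V_def VL_def map_V[symmetric] using outer
    by (intro lmat_of_poly_prod) (auto intro: poly_lift_carrier)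
  then have V: "V \<in> carrier_mat m m" "map_mat laurent_of_poly V = VL" by auto
  have "P \<in> carrier_mat m m \<and> map_mat laurent_of_poly P = PL"
    unfolding P_def PL_def map_P[symmetric] using nilp
    by (intro lmat_of_poly_prod) (auto intro: poly_lift_carrier)
  then have P: "P \<in> carrier_mat m m" "map_mat laurent_of_poly P = PL" by auto
  have cVL: "VL \<in> carrier_mat m m" and cPL: "PL \<in> carrier_mat m m" using V P by auto
  have cS: "const_pmat S \<in> carrier_mat m m" and cT: "const_pmat T \<in> carrier_mat m m"
    using S T by auto
  note cSL = const_lmat_carrier[OF S]
  have LL: "LL = VL * (PL * const_lmat S)"
  proof -
    have "LL = map_mat laurent_of_poly (V * C)"
      unfolding LL_def lmat_of_poly_blocks[symmetric] Lp_def[symmetric] Lp V_def ..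
    then show ?thesis
      unfolding CS P_def[symmetric] laurent_of_poly_hom.mat_hom_mult[OF V(1) mult_carrier_mat[OF P(1) cS]]
        laurent_of_poly_hom.mat_hom_mult[OF P(1) cS] lmat_of_poly_const V(2) P(2) .
  qed
  have "lmat_eval1 VL = 1\<^sub>m m" unfolding VL_def
    using outer by (intro lmat_eval1_lmat_prod) (auto intro: lift_L_carrier lmat_eval1_lift_L)
  moreover have "lmat_eval1 PL = 1\<^sub>m m" unfolding PL_def
    using nilp by (intro lmat_eval1_lmat_prod) (auto intro: lift_L_carrier lmat_eval1_lift_L)
  ultimately have "EL = S"
    unfolding EL_def LL laurent_eval1_hom.mat_hom_mult[OF cVL mult_carrier_mat[OF cPL cSL]]
      laurent_eval1_hom.mat_hom_mult[OF cPL cSL] lmat_eval1_const using S by simp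
  then have SGH: "S = diag_one m G * haar m" using EL by simp
  have G: "G \<in> carrier_mat (m - 1) (m - 1)" using GK(1) by (simp add: mats_over_iff)
  note D = diag_one_carrier[OF \<open>m > 0\<close> G]
  have fact: "LL = VL * PL * const_lmat (diag_one m G) * const_lmat (haar m)"
    unfolding LL SGH const_lmat_mult[OF D haar_carrier]
    using cVL cPL const_lmat_carrier[OF D] const_lmat_carrier[OF haar_carrier[of m]]
    by (simp add: assoc_mult_mat[of _ m m _ m _ m])
  have "P \<noteq> 0\<^sub>m m m"
  proof
    assume "P = 0\<^sub>m m m"
    then have "C = 0\<^sub>m m m" using CS cS by (simp add: P_def[symmetric])
    then show False using detC c(1) \<open>m > 0\<close> by simp
  qed
  \<comment> \<open>The product of the lifting factors is \<open>C\<close> times the inverse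
    \<open>T\<close> of the constant, and a constant factor does not raise degrees.\<close>
  moreover have "degree (P $$ (i, j)) \<le> g - 1" if "i < m" "j < m" for i j
  proof -
    have "P = P * const_pmat (S * T)"
      unfolding ST(3) const_poly_hom.mat_hom_one using P by simp
    then have "P = C * const_pmat T"
      unfolding const_poly_hom.mat_hom_mult[OF S T] CS P_def[symmetric]
      using assoc_mult_mat[OF P(1) cS cT] by simp
    then have "P $$ (i, j) = (\<Sum>s<m. C $$ (i, s) * const_pmat T $$ (s, j))"
      using index_mult_sum[OF C(1) cT that] by simp
    also have "\<dots> = (\<Sum>s<m. smult (T $$ (s, j)) (C $$ (i, s)))"
      using that T by (intro sum.cong) auto
    finally show ?thesis using C(3) that
      by (auto intro!: degree_sum_le intro: order.trans[OF degree_smult_le])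
  qed
  ultimately have "lmat_genus PL \<le> int g"
    unfolding P(2)[symmetric] using P(1) \<open>g > 0\<close> by (intro lmat_genus_of_poly_le) auto
  then show thesis
    using that[of c vs fs G K] c(1) detL vs fs GK fact unfolding LL_def VL_def PL_def by blast
qed

end

theorem theorem3p2:
  fixes F :: "complex set" and m g :: nat and L R :: "complex mat"
  assumes "conj_subfield F"
    and "haar_over F m"
    and "normalizable_over F m"
    and "m \<ge> 2"
    and "L \<in> mats_over F m (m * g)"
    and "R \<in> mats_over F m (m * g)"
  shows "biorthogonal_wavelet_pair m g L R \<longleftrightarrow>
    (\<exists>(k\<^sub>0::int) (b::int) (c::complex) (d::nat) (r::nat)
       (V :: nat \<Rightarrow> laurent mat) (N :: nat \<Rightarrow> complex mat) (k :: nat \<Rightarrow> nat)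
       (G :: complex mat) (Ginv :: complex mat).
       (\<forall>i\<in>{1..d}. primitive_paraunitary F m (V i)) \<and>
       (\<forall>i\<in>{1..r}. N i \<in> mats_over F m m \<and> N i * N i = 0\<^sub>m m m \<and> k i > 0) \<and>
       G \<in> mats_over F (m - 1) (m - 1) \<and> Ginv \<in> mats_over F (m - 1) (m - 1) \<and>
       inverts_mat G Ginv \<and> inverts_mat Ginv G \<and>
       c \<noteq> 0 \<and> det (blocks_to_lmat m g L) = Poly_Mapping.single (- b) c \<and>
       int d = b - int m * k\<^sub>0 \<and>
       lmat_genus (lmat_prod m (map (\<lambda>i. lift_L m (N i) (k i)) (rev [1..<Suc r]))) \<le> int g \<and>
       blocks_to_lmat m g L =
         zpow (- k\<^sub>0) \<cdot>\<^sub>m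
           (lmat_prod m (map V [1..<Suc d]) *
            lmat_prod m (map (\<lambda>i. lift_L m (N i) (k i)) (rev [1..<Suc r])) *
            const_lmat (diag_one m G) * const_lmat (haar m)) \<and>
       blocks_to_lmat m g R =
         zpow (- k\<^sub>0) \<cdot>\<^sub>m
           (lmat_prod m (map V [1..<Suc d]) *
            lmat_prod m (map (\<lambda>i. lift_R m (N i) (k i)) (rev [1..<Suc r])) *
            const_lmat (diag_one m (mat_adjoint Ginv)) * const_lmat (haar m)))"
proof -
  interpret conj_closed_subfield F using assms(1) by unfold_locales
  have "m > 0" using assms(4) by simp
  show ?thesis
  proof (rule iffI, goal_cases)
    case 1
    note bio = this
    obtain c vs fs G K where c: "c \<noteq> 0"
      and det: "det (blocks_to_lmat m g L) = Poly_Mapping.single (- int (length vs)) c"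
      and vs: "\<forall>v\<in>set vs. unit_vec_over F m v"
      and fs: "\<forall>(N, k)\<in>set fs. N \<in> mats_over F m m \<and> N * N = 0\<^sub>m m m \<and> k > 0"
      and GK: "G \<in> mats_over F (m - 1) (m - 1)" "K \<in> mats_over F (m - 1) (m - 1)"
        "G * K = 1\<^sub>m (m - 1)" "K * G = 1\<^sub>m (m - 1)"
      and genus: "lmat_genus (lmat_prod m (map (\<lambda>(N, k). lift_L m N k) fs)) \<le> int g"
      and fact: "blocks_to_lmat m g L = lmat_prod m (map (\<lambda>v. lift_L m (outer_self v) 1) vs) *
        lmat_prod m (map (\<lambda>(N, k). lift_L m N k) fs) * const_lmat (diag_one m G) * const_lmat (haar m)"
      by (rule wavelet_factorization[OF assms(2,3) \<open>m > 0\<close> assms(5,6) bio])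
    define d r where "d = length vs" and "r = length fs"
    define V where "V i = lift_L m (outer_self (vs ! (i - 1))) 1" for i
    \<comment> \<open>The list runs from left to right while the lifting factors are numbered from
      right to left, hence position \<open>r - i\<close>.\<close>
    define N k where "N i = fst (fs ! (r - i))" and "k i = snd (fs ! (r - i))" for i
    have mapV: "map (\<lambda>v. lift_L m (outer_self v) 1) vs = map V [1..<Suc d]"
      by (intro nth_equalityI) (auto simp: V_def d_def simp del: upt_Suc)
    have mapN: "map (\<lambda>(N, k). lift_L m N k) fs = map (\<lambda>i. lift_L m (N i) (k i)) (rev [1..<Suc r])"
      by (intro nth_equalityI) (auto simp: N_def k_def r_def rev_nth case_prod_beta simp del: upt_Suc)
    have pV: "\<forall>i\<in>{1..d}. primitive_paraunitary F m (V i)"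
    proof
      fix i assume "i \<in> {1..d}"
      then have "vs ! (i - 1) \<in> set vs" by (auto simp: d_def)
      then show "primitive_paraunitary F m (V i)" using vs unfolding primitive_paraunitary_lift V_def by blast
    qed
    have pN: "\<forall>i\<in>{1..r}. N i \<in> mats_over F m m \<and> N i * N i = 0\<^sub>m m m \<and> k i > 0"
    proof
      fix i assume "i \<in> {1..r}"
      then have "(N i, k i) \<in> set fs" by (auto simp: N_def k_def r_def)
      then show "N i \<in> mats_over F m m \<and> N i * N i = 0\<^sub>m m m \<and> k i > 0" using fs by blast
    qed
    \<comment> \<open>The partner assembled from the factors of \<open>L\<close>. It satisfies the
      same relation with \<open>L\<close> as \<open>R\<close> does, and \<open>L\<close> has nonzero
      determinant, so the two coincide.\<close>
    define R' where "R' = zpow (- 0) \<cdot>\<^sub>m (lmat_prod m (map V [1..<Suc d]) *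
      lmat_prod m (map (\<lambda>i. lift_R m (N i) (k i)) (rev [1..<Suc r])) *
      const_lmat (diag_one m (mat_adjoint K)) * const_lmat (haar m))"
    have L: "blocks_to_lmat m g L = zpow (- 0) \<cdot>\<^sub>m (lmat_prod m (map V [1..<Suc d]) *
      lmat_prod m (map (\<lambda>i. lift_L m (N i) (k i)) (rev [1..<Suc r])) *
      const_lmat (diag_one m G) * const_lmat (haar m))"
      unfolding fact mapV mapN by (intro eq_matI) (auto simp: zpow_0)
    have cG: "G \<in> carrier_mat (m - 1) (m - 1)" and cK: "K \<in> carrier_mat (m - 1) (m - 1)"
      using GK by (auto simp: mats_over_iff)
    have V': "\<forall>i\<in>set [1..<Suc d]. primitive_paraunitary F m (V i)" using pV by auto
    have N': "\<forall>i\<in>set (rev [1..<Suc r]). N i \<in> carrier_mat m m \<and> N i * N i = 0\<^sub>m m m"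
      using pN by (auto simp: mats_over_iff)
    note prod = factorization_biorthogonal[OF \<open>m > 0\<close> V' N' cG cK GK(3) L R'_def]
    have cR: "blocks_to_lmat m g R \<in> carrier_mat m m" by (rule blocks_to_lmat_carrier)
    have "blocks_to_lmat m g L * lmat_adjoint R' =
        blocks_to_lmat m g L * lmat_adjoint (blocks_to_lmat m g R)"
      using prod(3) bio by (simp add: biorthogonal_wavelet_pair_def)
    moreover have "det (blocks_to_lmat m g L) \<noteq> 0"
    proof
      assume "det (blocks_to_lmat m g L) = 0"
      then have "Poly_Mapping.lookup (Poly_Mapping.single (- int (length vs)) c) (- int (length vs)) = 0"
        using det by simp
      then show False using c by simp
    qed
    ultimately have "lmat_adjoint R' = lmat_adjoint (blocks_to_lmat m g R)"
      by (intro lmat_mult_left_cancel[OF prod(1) lmat_adjoint_carrier[OF prod(2)] lmat_adjoint_carrier[OF cR]])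
    then have "R' = blocks_to_lmat m g R"
      by (metis lmat_adjoint_adjoint)
    note R = this[symmetric, unfolded R'_def]
    have inv: "inverts_mat G K" "inverts_mat K G"
      using GK cG cK by (auto simp: inverts_mat_def)
    \<comment> \<open>The equation \<open>d = b - m k\<^sub>0\<close> for the witnesses
      \<open>k\<^sub>0 = 0\<close> and \<open>b = d\<close>.\<close>
    have "int d = int d - int m * 0" by simp
    note facts = pV pN GK(1,2) inv c det[folded d_def] this genus[unfolded mapN] L R
    show ?case
      by (rule exI[of _ 0], rule exI[of _ "int d"], rule exI[of _ c], rule exI[of _ d], rule exI[of _ r],
          rule exI[of _ V], rule exI[of _ N], rule exI[of _ k], rule exI[of _ G], rule exI[of _ K])
        (intro conjI facts)
  next
    case 2
    then obtain k\<^sub>0 :: int and d r V N k G K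
      where V: "\<forall>i\<in>{1..d}. primitive_paraunitary F m (V i)"
      and N: "\<forall>i\<in>{1..r}. N i \<in> mats_over F m m \<and> N i * N i = 0\<^sub>m m m \<and> k i > 0"
      and G: "G \<in> mats_over F (m - 1) (m - 1)" and K: "K \<in> mats_over F (m - 1) (m - 1)"
      and GK: "inverts_mat G K"
      and L: "blocks_to_lmat m g L = zpow (- k\<^sub>0) \<cdot>\<^sub>m (lmat_prod m (map V [1..<Suc d]) *
        lmat_prod m (map (\<lambda>i. lift_L m (N i) (k i)) (rev [1..<Suc r])) *
        const_lmat (diag_one m G) * const_lmat (haar m))"
      and R: "blocks_to_lmat m g R = zpow (- k\<^sub>0) \<cdot>\<^sub>m (lmat_prod m (map V [1..<Suc d]) *
        lmat_prod m (map (\<lambda>i. lift_R m (N i) (k i)) (rev [1..<Suc r])) *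
        const_lmat (diag_one m (mat_adjoint K)) * const_lmat (haar m))"
      by (elim exE conjE)
    have cG: "G \<in> carrier_mat (m - 1) (m - 1)" and cK: "K \<in> carrier_mat (m - 1) (m - 1)"
      using G K by (auto simp: mats_over_iff)
    have V': "\<forall>i\<in>set [1..<Suc d]. primitive_paraunitary F m (V i)" using V by auto
    have N': "\<forall>i\<in>set (rev [1..<Suc r]). N i \<in> carrier_mat m m \<and> N i * N i = 0\<^sub>m m m"
      using N by (auto simp: mats_over_iff)
    have "G * K = 1\<^sub>m (m - 1)" using GK cG by (simp add: inverts_mat_def)
    note prod = factorization_biorthogonal[OF \<open>m > 0\<close> V' N' cG cK this L R]
    show "biorthogonal_wavelet_pair m g L R"
      unfolding biorthogonal_wavelet_pair_eval1 prod(4,5)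
      using prod(3) diag_one_haar_row_sum[OF cG] diag_one_haar_row_sum[OF mat_adjoint_carrier[OF cK]]
      by simp
  qed
qed

end
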